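(* Let $X$ be an infinite dimensional separable Hilbert space endowed with a non-degenerate centered Gaussian measure $\gamma$ with covariance operator $Q$, and let $(\lambda_j)_{j\in\mathbb{N}}$, $j\ge1$, be the eigenvalues of $Q$ (repeated according to multiplicity) in non-increasing order. There exists a closed convex set $C\subset X$ with $P_\gamma(C)=+\infty$ and such that, moreover, if $$\sum_{j\in\mathbb{N}}\lambda_j\log j<+\infty,$$ then $C$ is compact.
   Context: $Q$ is the covariance operator of $\gamma$: $\langle Qx,y\rangle=\int_X\langle x,z\rangle\langle y,z\rangle\,d\gamma(z)$, an injective, symmetric, positive, trace class operator. The Cameron--Martin space of $\gamma$ is $H=Q^{1/2}X$ with inner product $[h,k]_H=\langle Q^{-1/2}h,Q^{-1/2}k\rangle$ and norm $|\cdot|_H$. Let $(e_j)$ be an orthonormal basis of $X$ with $Qe_j=\lambda_je_j$; then $h_j=\sqrt{\lambda_j}\,e_j$ is an orthonormal basis of $H$. Let $\partial_j$ be the derivative in the direction $h_j$, and $\hat h_j(x)=\langle x,e_j\rangle/\sqrt{\lambda_j}$. $\mathcal{F}C^1_b(X)$ is the set of functions $f(x)=\varphi(\langle x,\ell_1\rangle,\dots,\langle x,\ell_m\rangle)$ with $m\in\mathbb{N}$, $\ell_i\in X$, $\varphi\in C^1_b(\mathbb{R}^m)$; $\mathcal{F}C^1_b(X,H)$ is the linear span of the functions $f\ell$ with $f\in\mathcal{F}C^1_b(X)$, $\ell\in H$. The Gaussian divergence of $\varphi\in\mathcal{F}C^1_b(X,H)$ is $\mathrm{div}_\gamma\varphi=\sum_j\partial_j^*[\varphi,h_j]_H$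 with $\partial_j^*f=\partial_jf-\hat h_jf$. Perimeter: for measurable $E\subseteq X$, $P_\gamma(E):=\sup\{\int_E\mathrm{div}_\gamma\varphi\,d\gamma:\ \varphi\in\mathcal{F}C^1_b(X,H),\ |\varphi(x)|_H\le1\ \forall x\in X\}\in[0,+\infty]$. *)

theory Defs
  imports "HOL-Probability.Probability"
begin

section \<open>Gaussian measures and their covariance\<close>

(* Every functional x has a centered Gaussian law; the law of variance 0 is the Dirac mass at 0. *)
definition centered_gaussian :: "'a::{real_inner, polish_space} measure \<Rightarrow> bool" where
  "centered_gaussian \<gamma> \<longleftrightarrow> prob_space \<gamma> \<and> sets \<gamma> = sets borel \<and>
     (\<forall>x. (AE z in \<gamma>. x \<bullet> z = 0) \<or>
          (\<exists>\<sigma>>0. distributed \<gamma> lborel (\<lambda>z. x \<bullet> z) (\<lambda>t. ennreal (normal_density 0 \<sigma> t))))"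

definition covariance_operator :: "'a::{real_inner, polish_space} measure \<Rightarrow> ('a \<Rightarrow> 'a) \<Rightarrow> bool" where
  "covariance_operator \<gamma> Q \<longleftrightarrow> (\<forall>x y. Q x \<bullet> y = (\<integral>z. (x \<bullet> z) * (y \<bullet> z) \<partial>\<gamma>))"

definition orthonormal_basis :: "(nat \<Rightarrow> 'a::{real_inner, polish_space}) \<Rightarrow> bool" where
  "orthonormal_basis e \<longleftrightarrow> (\<forall>i j. e i \<bullet> e j = (if i = j then 1 else 0)) \<and>
     closure (span (range e)) = UNIV"

(* Indices start at 0: e j and lam j are the mathematical e_{j+1} and lambda_{j+1}.  Since e is an
   orthonormal basis, lam lists all eigenvalues of Q, repeated according to multiplicity. *)
definition ordered_eigenbasis ::
    "('a::{real_inner, polish_space} \<Rightarrow> 'a) \<Rightarrow> (nat \<Rightarrow> 'a) \<Rightarrow> (nat \<Rightarrow> real) \<Rightarrow> bool" where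
  "ordered_eigenbasis Q e lam \<longleftrightarrow>
     orthonormal_basis e \<and> (\<forall>j. Q (e j) = lam j *\<^sub>R e j) \<and> decseq lam"

section \<open>The Cameron--Martin space\<close>

(* The unique positive symmetric square root. *)
definition op_sqrt :: "('a::{real_inner, polish_space} \<Rightarrow> 'a) \<Rightarrow> 'a \<Rightarrow> 'a" where
  "op_sqrt Q = (THE S. bounded_linear S \<and> (\<forall>x y. S x \<bullet> y = x \<bullet> S y) \<and>
                       (\<forall>x. 0 \<le> S x \<bullet> x) \<and> (\<forall>x. S (S x) = Q x))"

definition CM_space :: "('a::{real_inner, polish_space} \<Rightarrow> 'a) \<Rightarrow> 'a set" where
  "CM_space Q = range (op_sqrt Q)"

(* For injective Q, op_sqrt Q is injective, so inv (op_sqrt Q) is its inverse on CM_space Q;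
   off CM_space Q the values of CM_inner and CM_norm are irrelevant. *)
definition CM_inner :: "('a::{real_inner, polish_space} \<Rightarrow> 'a) \<Rightarrow> 'a \<Rightarrow> 'a \<Rightarrow> real" where
  "CM_inner Q h k = inv (op_sqrt Q) h \<bullet> inv (op_sqrt Q) k"

definition CM_norm :: "('a::{real_inner, polish_space} \<Rightarrow> 'a) \<Rightarrow> 'a \<Rightarrow> real" where
  "CM_norm Q h = sqrt (CM_inner Q h h)"

definition CM_basis :: "(nat \<Rightarrow> 'a::{real_inner, polish_space}) \<Rightarrow> (nat \<Rightarrow> real) \<Rightarrow> nat \<Rightarrow> 'a" where
  "CM_basis e lam j = sqrt (lam j) *\<^sub>R e j"

section \<open>Cylindrical functions and fields\<close>

(* The library space Euclidean_space m models R^m as the maps v :: nat => real with v i = 0 for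
   i >= m.  Being C^1 means that all partial derivatives exist and are continuous. *)
definition partial_deriv :: "nat \<Rightarrow> ((nat \<Rightarrow> real) \<Rightarrow> real) \<Rightarrow> (nat \<Rightarrow> real) \<Rightarrow> real" where
  "partial_deriv i \<phi> v = deriv (\<lambda>t. \<phi> (v(i := t))) (v i)"

definition C1_bounded :: "nat \<Rightarrow> ((nat \<Rightarrow> real) \<Rightarrow> real) \<Rightarrow> bool" where
  "C1_bounded m \<phi> \<longleftrightarrow>
     continuous_map (Euclidean_space m) euclideanreal \<phi> \<and>
     bounded (\<phi> ` topspace (Euclidean_space m)) \<and>
     (\<forall>i<m. (\<forall>v\<in>topspace (Euclidean_space m). (\<lambda>t. \<phi> (v(i := t))) differentiable at (v i)) \<and>
            continuous_map (Euclidean_space m) euclideanreal (partial_deriv i \<phi>) \<and>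
            bounded (partial_deriv i \<phi> ` topspace (Euclidean_space m)))"

definition FC1b :: "('a::{real_inner, polish_space} \<Rightarrow> real) set" where
  "FC1b = {f. \<exists>m l \<phi>. C1_bounded m \<phi> \<and> f = (\<lambda>x. \<phi> (\<lambda>i. if i < m then x \<bullet> l i else 0))}"

definition FC1b_fields :: "('a::{real_inner, polish_space} \<Rightarrow> 'a) \<Rightarrow> ('a \<Rightarrow> 'a) set" where
  "FC1b_fields Q = {F. \<exists>(n::nat) c f l. (\<forall>i<n. f i \<in> FC1b \<and> l i \<in> CM_space Q) \<and>
                        F = (\<lambda>x. \<Sum>i<n. c i *\<^sub>R (f i x *\<^sub>R l i))}"

section \<open>Gaussian divergence and perimeter\<close>

definition dir_deriv ::
    "(nat \<Rightarrow> 'a::{real_inner, polish_space}) \<Rightarrow> (nat \<Rightarrow> real) \<Rightarrow> nat \<Rightarrow> ('a \<Rightarrow> real) \<Rightarrow> 'a \<Rightarrow> real" where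
  "dir_deriv e lam j f x = deriv (\<lambda>t. f (x + t *\<^sub>R CM_basis e lam j)) 0"

definition h_hat ::
    "(nat \<Rightarrow> 'a::{real_inner, polish_space}) \<Rightarrow> (nat \<Rightarrow> real) \<Rightarrow> nat \<Rightarrow> 'a \<Rightarrow> real" where
  "h_hat e lam j x = (x \<bullet> e j) / sqrt (lam j)"

definition dir_deriv_adj ::
    "(nat \<Rightarrow> 'a::{real_inner, polish_space}) \<Rightarrow> (nat \<Rightarrow> real) \<Rightarrow> nat \<Rightarrow> ('a \<Rightarrow> real) \<Rightarrow> 'a \<Rightarrow> real" where
  "dir_deriv_adj e lam j f x = dir_deriv e lam j f x - h_hat e lam j x * f x"

(* For a field in FC1b_fields Q the series converges gamma-almost everywhere and in L^2(gamma),
   with the same sum, but not necessarily at every point: the coefficients [l, h_j]_H are merely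
   square summable.  The value of suminf on the exceptional null set does not matter. *)
definition gauss_div ::
    "('a::{real_inner, polish_space} \<Rightarrow> 'a) \<Rightarrow> (nat \<Rightarrow> 'a) \<Rightarrow> (nat \<Rightarrow> real) \<Rightarrow> ('a \<Rightarrow> 'a) \<Rightarrow> 'a \<Rightarrow> real" where
  "gauss_div Q e lam F x =
     (\<Sum>j. dir_deriv_adj e lam j (\<lambda>y. CM_inner Q (F y) (CM_basis e lam j)) x)"

definition gauss_perimeter ::
    "'a::{real_inner, polish_space} measure \<Rightarrow> ('a \<Rightarrow> 'a) \<Rightarrow> (nat \<Rightarrow> 'a) \<Rightarrow> (nat \<Rightarrow> real) \<Rightarrow> 'a set \<Rightarrow> ereal" where
  "gauss_perimeter \<gamma> Q e lam E =
     (SUP F \<in> {F \<in> FC1b_fields Q. \<forall>x. CM_norm Q (F x) \<le> 1}.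
        ereal (LINT x:E|\<gamma>. gauss_div Q e lam F x))"

end

theory Submission
  imports Defs "HOL-Real_Asymp.Real_Asymp"
begin

text \<open>The normalised coordinates $\hat h_j$ are independent standard Gaussian variables under
  $\gamma$, and $C$ is a box $\{x : |\hat h_j(x)| \le c_j \mbox{ for all } j\}$.  The half-space beyond
  the $j$-th face has measure of order $e^{-c_j^2/2}/c_j$, while its boundary has Gaussian area of
  order $e^{-c_j^2/2}$.  If $c_j$ grows like $\sqrt{2 \log j}$, with a correction that makes
  $e^{-c_j^2/2} = 1/(j \log j)$, then the measures are summable, so that $C$ has positive measure, but
  the perimeter is infinite, because a fixed fraction of every boundary hyperplane lies in $C$
  (lemma \<open>obtain_side_lengths\<close> constructs such $c_j$).

  For the lower bound on $P_\gamma(C)$, let $\psi_j$ be a smooth step that rises from $0$ at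
  $c_j - 1/c_j$ to $1/2$ at $c_j$, and consider
  \[ F_n = \sum_{j<n} \psi_j(\hat h_j) \prod_{i<n,\, i \ne j} (1 - \psi_i(\hat h_i))\, h_j . \]
  The coefficients are the probabilities of exactly one success among $n$ independent trials, so
  $|F_n|_H \le 1$.  Independence turns $\int_C \mathrm{div}_\gamma F_n\,d\gamma$ into a sum of products of
  one-dimensional integrals; in the $j$-th product the $j$-th factor is $\varphi(c_j)/2$, with
  $\varphi$ the standard normal density, by the fundamental theorem of calculus, and the remaining
  factors multiply to at least $1/2$ (\<open>integral_box_test_term\<close>).  Hence
  $P_\gamma(C) \ge \frac14 \sum_{j<n} \varphi(c_j)$ for all $n$.

  Two ingredients link this computation to the abstract definitions.  The unique positive square
  root of $Q$ is diagonal in the eigenbasis (\<open>op_sqrt_coordinate\<close>), which makes the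
  Cameron--Martin norm and the divergence of $F_n$ explicit.  Independence follows from the Gaussian
  laws of the one-dimensional marginals alone, one coordinate at a time, by uniqueness of
  characteristic functions on the line (\<open>decoupled_Suc\<close>).

  In terms of $x$ the box is $|\langle x, e_j\rangle| \le \sqrt{\lambda_j}\, c_j$, and
  $\lambda_j c_j^2$ is of order $\lambda_j \log j$; a box with square summable side lengths is
  compact.\<close>

section \<open>Orthonormal expansions\<close>

lemma orthonormal_basis_inner:
  "orthonormal_basis e \<Longrightarrow> e i \<bullet> e j = (if i = j then 1 else 0)"
  by (simp add: orthonormal_basis_def)

lemma orthonormal_basis_eqI:
  fixes e :: "nat \<Rightarrow> 'a::{real_inner, polish_space}"
  assumes e: "orthonormal_basis e" and xy: "\<And>j. x \<bullet> e j = y \<bullet> e j"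
  shows "x = y"
proof -
  let ?S = "{w. (x - y) \<bullet> w = 0}"
  have "closed ?S"
    by (intro closed_Collect_eq continuous_intros)
  moreover have "span (range e) \<subseteq> ?S"
    by (intro span_minimal subspaceI) (auto simp: inner_diff_left inner_add_right xy)
  ultimately have "closure (span (range e)) \<subseteq> ?S"
    by (simp add: closure_minimal)
  then have "x - y \<in> ?S"
    using e unfolding orthonormal_basis_def by blast
  then show ?thesis by simp
qed

lemma inner_orthonormal_sum:
  assumes "orthonormal_basis e" and "finite A"
  shows "(\<Sum>j\<in>A. a j *\<^sub>R e j) \<bullet> e k = (if k \<in> A then a k else 0)"
  using assms by (simp add: inner_sum_left orthonormal_basis_inner if_distrib cong: if_cong)

lemma norm_orthonormal_sum:
  assumes "orthonormal_basis e" and "finite A"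
  shows "(norm (\<Sum>j\<in>A. a j *\<^sub>R e j))\<^sup>2 = (\<Sum>j\<in>A. (a j)\<^sup>2)"
  unfolding power2_norm_eq_inner inner_sum_right
  using assms by (intro sum.cong) (auto simp: inner_orthonormal_sum power2_eq_square)

lemma bessel_inequality:
  assumes "orthonormal_basis e" and "finite A"
  shows "(\<Sum>j\<in>A. (x \<bullet> e j)\<^sup>2) \<le> (norm x)\<^sup>2"
proof -
  let ?p = "\<Sum>j\<in>A. (x \<bullet> e j) *\<^sub>R e j"
  have "x \<bullet> ?p = (\<Sum>j\<in>A. (x \<bullet> e j)\<^sup>2)"
    by (simp add: inner_sum_right power2_eq_square)
  moreover have "?p \<bullet> ?p = (\<Sum>j\<in>A. (x \<bullet> e j)\<^sup>2)"
    using norm_orthonormal_sum[OF assms, of "\<lambda>j. x \<bullet> e j"] by (simp add: power2_norm_eq_inner)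
  ultimately have "(norm (x - ?p))\<^sup>2 = (norm x)\<^sup>2 - (\<Sum>j\<in>A. (x \<bullet> e j)\<^sup>2)"
    by (simp add: power2_norm_eq_inner inner_diff_left inner_diff_right inner_commute)
  then show ?thesis
    by (smt (verit) zero_le_power2)
qed

lemma summable_bessel:
  assumes "orthonormal_basis e"
  shows "summable (\<lambda>j. (x \<bullet> e j)\<^sup>2)"
  using bessel_inequality[OF assms] by (intro summableI_nonneg_bounded[where x = "(norm x)\<^sup>2"]) auto

text \<open>Completeness of the space enters here, through the Cauchy criterion for the partial sums.\<close>

lemma summable_orthonormal:
  fixes e :: "nat \<Rightarrow> 'a::{real_inner, polish_space}"
  assumes e: "orthonormal_basis e" and a: "summable (\<lambda>j. (a j)\<^sup>2)"
  shows "summable (\<lambda>j. a j *\<^sub>R e j)"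
proof -
  let ?s = "\<lambda>n. \<Sum>j<n. a j *\<^sub>R e j" and ?S = "\<lambda>n. \<Sum>j<n. (a j)\<^sup>2"
  have diff: "(norm (?s n - ?s m))\<^sup>2 = \<bar>?S n - ?S m\<bar>" for m n
  proof (induction m n rule: linorder_wlog)
    case (le m n)
    have "(norm (?s n - ?s m))\<^sup>2 = (\<Sum>j\<in>{m..<n}. (a j)\<^sup>2)"
      using le norm_orthonormal_sum[OF e, of "{m..<n}"]
      by (simp add: sum_diff_nat_ivl lessThan_atLeast0)
    also have "\<dots> = ?S n - ?S m"
      using le by (simp add: sum_diff_nat_ivl lessThan_atLeast0)
    also have "\<dots> = \<bar>?S n - ?S m\<bar>"
      using calculation by (metis abs_of_nonneg zero_le_power2)
    finally show ?case .
  next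
    case (sym m n)
    then show ?case by (simp add: norm_minus_commute abs_minus_commute)
  qed
  have "Cauchy ?s"
  proof (rule CauchyI)
    fix r :: real assume "0 < r"
    have "Cauchy ?S"
      using a by (simp add: summable_iff_convergent convergent_Cauchy)
    then obtain N where N: "\<And>m n. N \<le> m \<Longrightarrow> N \<le> n \<Longrightarrow> \<bar>?S m - ?S n\<bar> < r\<^sup>2"
      using \<open>0 < r\<close> by (metis CauchyD real_norm_def zero_less_power)
    show "\<exists>N. \<forall>m\<ge>N. \<forall>n\<ge>N. norm (?s m - ?s n) < r"
    proof (intro exI allI impI)
      fix m n assume "N \<le> m" "N \<le> n"
      then have "(norm (?s m - ?s n))\<^sup>2 < r\<^sup>2" using N by (simp add: diff)
      then show "norm (?s m - ?s n) < r" using \<open>0 < r\<close> by (meson less_imp_le power2_less_imp_less)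
    qed
  qed
  then show ?thesis
    by (simp add: summable_iff_convergent Cauchy_convergent)
qed

lemma suminf_orthonormal_inner:
  fixes e :: "nat \<Rightarrow> 'a::{real_inner, polish_space}"
  assumes e: "orthonormal_basis e" and a: "summable (\<lambda>j. (a j)\<^sup>2)"
  shows "(\<Sum>j. a j *\<^sub>R e j) \<bullet> e k = a k"
proof -
  have "(\<lambda>j. (a j *\<^sub>R e j) \<bullet> e k) sums ((\<Sum>j. a j *\<^sub>R e j) \<bullet> e k)"
    by (intro bounded_linear.sums[OF bounded_linear_inner_left] summable_sums
        summable_orthonormal assms)
  moreover have "(\<lambda>j. (a j *\<^sub>R e j) \<bullet> e k) sums a k"
    using sums_single[of k a] by (simp add: orthonormal_basis_inner[OF e] if_distrib cong: if_cong)
  ultimately show ?thesis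
    by (rule sums_unique2)
qed

lemma orthonormal_expansion:
  fixes e :: "nat \<Rightarrow> 'a::{real_inner, polish_space}"
  assumes e: "orthonormal_basis e"
  shows "(\<lambda>j. (x \<bullet> e j) *\<^sub>R e j) sums x"
proof -
  have "(\<Sum>j. (x \<bullet> e j) *\<^sub>R e j) = x"
    by (rule orthonormal_basis_eqI[OF e])
      (simp add: suminf_orthonormal_inner[OF e summable_bessel[OF e]])
  then show ?thesis
    using summable_sums[OF summable_orthonormal[OF e summable_bessel[OF e]], of x] by simp
qed

lemma parseval_inner:
  fixes e :: "nat \<Rightarrow> 'a::{real_inner, polish_space}"
  assumes e: "orthonormal_basis e"
  shows "(\<lambda>j. (x \<bullet> e j) * (y \<bullet> e j)) sums (x \<bullet> y)"
  using bounded_linear.sums[OF bounded_linear_inner_left orthonormal_expansion[OF e], of x y]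
  by (simp add: inner_commute)

text \<open>A coordinate box with square summable side lengths is the image of a compact cube in the
  product space under the map $v \mapsto \sum_j v_j e_j$, which is continuous on the cube because
  the partial sums converge uniformly there.\<close>

lemma compact_orthonormal_box:
  fixes e :: "nat \<Rightarrow> 'a::{real_inner, polish_space}"
  assumes e: "orthonormal_basis e" and r: "summable (\<lambda>j. (r j)\<^sup>2)"
  shows "compact {x. \<forall>j. \<bar>x \<bullet> e j\<bar> \<le> r j}"
proof -
  let ?B = "Pi\<^sub>E UNIV (\<lambda>j. {- r j .. r j})"
  let ?f = "\<lambda>n v. \<Sum>j<n. v j *\<^sub>R e j" and ?g = "\<lambda>v. \<Sum>j. v j *\<^sub>R e j"
  have sq: "summable (\<lambda>j. (v j)\<^sup>2)" and sq_le: "\<And>j. (v j)\<^sup>2 \<le> (r j)\<^sup>2" if "v \<in> ?B" for v :: "nat \<Rightarrow> real"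
  proof -
    show le: "(v j)\<^sup>2 \<le> (r j)\<^sup>2" for j
    proof -
      have "v j \<in> {- r j .. r j}" using that by (auto simp: PiE_iff)
      then show ?thesis by (simp add: abs_le_square_iff[symmetric] abs_le_iff)
    qed
    show "summable (\<lambda>j. (v j)\<^sup>2)"
      by (rule summable_comparison_test[OF _ r]) (use le in auto)
  qed
  have "uniform_limit ?B ?f ?g sequentially"
  proof (rule uniform_limitI)
    fix \<epsilon> :: real assume "0 < \<epsilon>"
    have "eventually (\<lambda>n. (\<Sum>j. (r (j + n))\<^sup>2) < \<epsilon>\<^sup>2) sequentially"
      using suminf_exist_split[of "\<epsilon>\<^sup>2" "\<lambda>j. (r j)\<^sup>2"] r \<open>0 < \<epsilon>\<close>
      by (fastforce simp: eventually_sequentially)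
    then show "\<forall>\<^sub>F n in sequentially. \<forall>v\<in>?B. dist (?f n v) (?g v) < \<epsilon>"
    proof eventually_elim
      case (elim n)
      show ?case
      proof
        fix v assume v: "v \<in> ?B"
        have sm: "summable (\<lambda>j. v j *\<^sub>R e j)" using summable_orthonormal[OF e sq[OF v]] .
        let ?y = "?g v - ?f n v"
        have coord: "?y \<bullet> e j = (if j < n then 0 else v j)" for j
          by (simp add: inner_diff_left suminf_orthonormal_inner[OF e sq[OF v]]
              inner_orthonormal_sum[OF e])
        have "(\<lambda>j. (?y \<bullet> e j)\<^sup>2) sums (norm ?y)\<^sup>2"
          using parseval_inner[OF e, of ?y ?y] by (simp only: power2_eq_square[symmetric] power2_norm_eq_inner)
        then have "(\<lambda>j. (?y \<bullet> e (j + n))\<^sup>2) sums (norm ?y)\<^sup>2"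
          by (subst sums_iff_shift) (simp add: coord)
        then have "(norm ?y)\<^sup>2 = (\<Sum>j. (v (j + n))\<^sup>2)"
          by (simp add: coord sums_iff)
        also have "\<dots> \<le> (\<Sum>j. (r (j + n))\<^sup>2)"
          by (intro suminf_le) (use sq_le[OF v] in
              \<open>auto intro!: summable_ignore_initial_segment sq[OF v] r\<close>)
        also have "\<dots> < \<epsilon>\<^sup>2" by (rule elim)
        finally show "dist (?f n v) (?g v) < \<epsilon>"
          using \<open>0 < \<epsilon>\<close> by (simp add: dist_norm norm_minus_commute power2_less_imp_less)
      qed
    qed
  qed
  then have "continuous_on ?B ?g"
    by (rule uniform_limit_theorem[rotated])
      (auto intro!: always_eventually continuous_on_sum continuous_on_scaleR continuous_on_const
        continuous_on_subset[OF continuous_on_product_coordinates])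
  moreover have "compact ?B"
  proof -
    have "compactin (product_topology (\<lambda>_. euclideanreal) UNIV) ?B"
      by (simp add: compactin_PiE)
    then show ?thesis by (simp add: euclidean_product_topology)
  qed
  ultimately have "compact (?g ` ?B)"
    by (rule compact_continuous_image)
  moreover have sub: "{x. \<forall>j. \<bar>x \<bullet> e j\<bar> \<le> r j} \<subseteq> ?g ` ?B"
  proof
    fix x assume "x \<in> {x. \<forall>j. \<bar>x \<bullet> e j\<bar> \<le> r j}"
    then have B: "(\<lambda>j. x \<bullet> e j) \<in> ?B" by (auto simp: abs_le_iff minus_le_iff)
    have "x = ?g (\<lambda>j. x \<bullet> e j)"
      using orthonormal_expansion[OF e] by (simp add: sums_iff)
    then show "x \<in> ?g ` ?B" using B by (rule image_eqI)
  qed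
  moreover have "closed {x. \<forall>j. \<bar>x \<bullet> e j\<bar> \<le> r j}"
    by (intro closed_Collect_all closed_Collect_le continuous_intros)
  ultimately have "compact (?g ` ?B \<inter> {x. \<forall>j. \<bar>x \<bullet> e j\<bar> \<le> r j})"
    by (intro compact_Int_closed)
  then show ?thesis
    by (simp only: Int_absorb1[OF sub])
qed

section \<open>The square root of the covariance and the Cameron--Martin space\<close>

locale gaussian_eigenbasis =
  fixes \<gamma> :: "'a::{real_inner, polish_space} measure"
    and Q :: "'a \<Rightarrow> 'a"
    and e :: "nat \<Rightarrow> 'a"
    and lam :: "nat \<Rightarrow> real"
  assumes gaussian: "centered_gaussian \<gamma>"
    and covariance: "covariance_operator \<gamma> Q"
    and inj_Q: "inj Q"
    and eigenbasis: "ordered_eigenbasis Q e lam"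
begin

sublocale prob_space \<gamma>
  using gaussian by (simp add: centered_gaussian_def)

lemma sets_gaussian [simp, measurable_cong]: "sets \<gamma> = sets borel"
  using gaussian by (simp add: centered_gaussian_def)

lemma space_gaussian [simp]: "space \<gamma> = UNIV"
  using sets_eq_imp_space_eq[OF sets_gaussian] by simp

lemma basis: "orthonormal_basis e"
  using eigenbasis by (simp add: ordered_eigenbasis_def)

lemmas basis_inner = orthonormal_basis_inner[OF basis]

lemma Q_inner: "Q x \<bullet> y = (\<integral>z. (x \<bullet> z) * (y \<bullet> z) \<partial>\<gamma>)"
  using covariance by (simp add: covariance_operator_def)

lemma Q_symmetric: "Q x \<bullet> y = x \<bullet> Q y"
  by (subst inner_commute[of x]) (simp add: Q_inner mult.commute)

lemma Q_basis: "Q (e j) = lam j *\<^sub>R e j"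
  using eigenbasis by (simp add: ordered_eigenbasis_def)

lemma Q_coordinate: "Q x \<bullet> e j = lam j * (x \<bullet> e j)"
  by (simp add: Q_symmetric Q_basis)

lemma Q_zero: "Q 0 = 0"
  by (rule orthonormal_basis_eqI[OF basis]) (simp add: Q_coordinate)

lemma lam_pos: "0 < lam j"
proof -
  have "lam j = Q (e j) \<bullet> e j"
    by (simp add: Q_basis basis_inner)
  then have "0 \<le> lam j"
    by (simp add: Q_inner)
  moreover have "lam j \<noteq> 0"
  proof
    assume "lam j = 0"
    then have "e j = 0"
      using Q_basis[of j] Q_zero injD[OF inj_Q, of "e j" 0] by simp
    then show False
      using basis_inner[of j j] by simp
  qed
  ultimately show ?thesis by simp
qed

text \<open>The operator that is diagonal in the eigenbasis with entries $\sqrt{\lambda_j}$ is a positive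
  symmetric square root of $Q$.  It is the only one: if $S$ is another and
  $u = S e_j - \sqrt{\lambda_j}\, e_j$, then $S u = -\sqrt{\lambda_j}\, u$, so positivity of $S$
  forces $u = 0$; two bounded operators that agree on a basis are equal.\<close>

lemma op_sqrt_coordinate_inj:
  shows op_sqrt_coordinate: "op_sqrt Q x \<bullet> e j = sqrt (lam j) * (x \<bullet> e j)"
    and inj_op_sqrt: "inj (op_sqrt Q)"
proof -
  let ?R = "\<lambda>S. bounded_linear S \<and> (\<forall>x y. S x \<bullet> y = x \<bullet> S y) \<and>
    (\<forall>x. 0 \<le> S x \<bullet> x) \<and> (\<forall>x. S (S x) = Q x)"
  define D where "D x = (\<Sum>j. (sqrt (lam j) * (x \<bullet> e j)) *\<^sub>R e j)" for x
  have lam_le: "lam j \<le> lam 0" for j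
    using eigenbasis by (simp add: ordered_eigenbasis_def decseq_def)
  have sq_le: "(sqrt (lam j) * (x \<bullet> e j))\<^sup>2 \<le> lam 0 * (x \<bullet> e j)\<^sup>2" for x j
    using lam_le[of j] lam_pos[of j] by (simp add: power_mult_distrib mult_right_mono)
  have sm: "summable (\<lambda>j. (sqrt (lam j) * (x \<bullet> e j))\<^sup>2)" for x
    by (rule summable_comparison_test[OF _ summable_mult[OF summable_bessel[OF basis]]])
      (use sq_le in auto)
  have D_coord: "D x \<bullet> e j = sqrt (lam j) * (x \<bullet> e j)" for x j
    unfolding D_def by (rule suminf_orthonormal_inner[OF basis sm])
  have D_inner: "(\<lambda>j. sqrt (lam j) * ((x \<bullet> e j) * (y \<bullet> e j))) sums (D x \<bullet> y)" for x y
    using parseval_inner[OF basis, of "D x" y] by (simp add: D_coord mult.assoc)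
  have D_norm: "norm (D x) \<le> norm x * sqrt (lam 0)" for x
  proof -
    have "(\<lambda>j. (sqrt (lam j) * (x \<bullet> e j))\<^sup>2) sums (D x \<bullet> D x)"
      using parseval_inner[OF basis, of "D x" "D x"] by (simp add: D_coord power2_eq_square)
    moreover have "(\<lambda>j. lam 0 * (x \<bullet> e j)\<^sup>2) sums (lam 0 * (x \<bullet> x))"
      using sums_mult[OF parseval_inner[OF basis, of x x]] by (simp add: power2_eq_square)
    ultimately have "D x \<bullet> D x \<le> lam 0 * (x \<bullet> x)"
      by (rule sums_le[OF sq_le])
    then show ?thesis
      by (metis mult.commute norm_eq_sqrt_inner real_sqrt_le_mono real_sqrt_mult)
  qed
  have "bounded_linear D"
    by (rule bounded_linear_intro[OF _ _ D_norm]; rule orthonormal_basis_eqI[OF basis])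
      (simp_all add: D_coord inner_add_left algebra_simps)
  moreover have "D x \<bullet> y = x \<bullet> D y" for x y
    using sums_unique2[OF D_inner[of x y], of "D y \<bullet> x"] D_inner[of y x]
    by (simp add: mult.commute inner_commute)
  moreover have "0 \<le> D x \<bullet> x" for x
    by (rule sums_le[OF _ sums_zero D_inner]) (simp add: lam_pos less_imp_le)
  moreover have "D (D x) = Q x" for x
    by (rule orthonormal_basis_eqI[OF basis]) (use lam_pos in \<open>simp add: D_coord Q_coordinate
      less_imp_le flip: mult.assoc\<close>)
  ultimately have "?R D" by blast
  moreover have "S = D" if "?R S" for S
  proof
    interpret bounded_linear S using that by blast
    have S: "S (e j) = sqrt (lam j) *\<^sub>R e j" for j
    proof -
      define u where "u = S (e j) - sqrt (lam j) *\<^sub>R e j"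
      have "S u = - sqrt (lam j) *\<^sub>R u"
        using that lam_pos[of j]
        by (simp add: u_def diff scale Q_basis scaleR_diff_right less_imp_le)
      then have "sqrt (lam j) * (u \<bullet> u) \<le> 0"
        using that by (metis inner_scaleR_left minus_mult_left neg_0_le_iff_le)
      then have "u = 0"
        using lam_pos[of j] by (simp add: mult_le_0_iff not_less)
          (meson inner_eq_zero_iff inner_ge_zero antisym real_sqrt_gt_zero not_le)
      then show ?thesis by (simp add: u_def)
    qed
    fix x show "S x = D x"
      by (rule orthonormal_basis_eqI[OF basis]) (use that in \<open>simp add: S D_coord\<close>)
  qed
  ultimately have eq: "op_sqrt Q = D"
    unfolding op_sqrt_def by (rule the_equality)
  show "op_sqrt Q x \<bullet> e j = sqrt (lam j) * (x \<bullet> e j)"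
    by (simp add: eq D_coord)
  show "inj (op_sqrt Q)"
  proof (rule injI)
    fix x y assume "op_sqrt Q x = op_sqrt Q y"
    then have "Q x = Q y" by (metis eq \<open>?R D\<close>)
    then show "x = y" by (rule injD[OF inj_Q])
  qed
qed

lemma op_sqrt_sum:
  assumes "finite A"
  shows "op_sqrt Q (\<Sum>j\<in>A. a j *\<^sub>R e j) = (\<Sum>j\<in>A. a j *\<^sub>R CM_basis e lam j)"
proof -
  have "(\<Sum>j\<in>A. a j *\<^sub>R CM_basis e lam j) = (\<Sum>j\<in>A. (a j * sqrt (lam j)) *\<^sub>R e j)"
    by (simp add: CM_basis_def)
  then show ?thesis
    by (intro orthonormal_basis_eqI[OF basis])
      (simp add: op_sqrt_coordinate inner_orthonormal_sum[OF basis assms])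
qed

lemma op_sqrt_basis: "op_sqrt Q (e j) = CM_basis e lam j"
  using op_sqrt_sum[of "{j}" "\<lambda>_. 1"] by simp

lemma CM_basis_in_CM_space: "CM_basis e lam j \<in> CM_space Q"
  unfolding CM_space_def by (metis op_sqrt_basis rangeI)

lemma CM_inner_basis:
  assumes "finite A"
  shows "CM_inner Q (\<Sum>j\<in>A. a j *\<^sub>R CM_basis e lam j) (CM_basis e lam k) =
    (if k \<in> A then a k else 0)"
  unfolding CM_inner_def op_sqrt_sum[OF assms, symmetric] unfolding op_sqrt_basis[symmetric]
  by (simp add: inv_f_f[OF inj_op_sqrt] inner_orthonormal_sum[OF basis assms])

lemma CM_norm_basis:
  assumes "finite A"
  shows "CM_norm Q (\<Sum>j\<in>A. a j *\<^sub>R CM_basis e lam j) = sqrt (\<Sum>j\<in>A. (a j)\<^sup>2)"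
  unfolding CM_norm_def CM_inner_def op_sqrt_sum[OF assms, symmetric]
  by (simp add: inv_f_f[OF inj_op_sqrt] norm_orthonormal_sum[OF basis assms]
      flip: power2_norm_eq_inner)

section \<open>Independence of the coordinates\<close>

lemma inner_measurable [measurable]: "(\<lambda>z. x \<bullet> z) \<in> borel_measurable \<gamma>"
  by (simp add: measurable_cong_sets[OF sets_gaussian refl] borel_measurable_continuous_onI
      continuous_intros)

text \<open>The parameter $\sigma$ in the definition of a centered Gaussian measure is forced to be
  $\langle Qx, x\rangle^{1/2}$, and the degenerate law occurs exactly when this vanishes.\<close>

lemma functional_cases:
  obtains (zero) "Q x \<bullet> x = 0" "AE z in \<gamma>. x \<bullet> z = 0"
  | (normal) "0 < Q x \<bullet> x"
      "distributed \<gamma> lborel (\<lambda>z. x \<bullet> z / sqrt (Q x \<bullet> x)) std_normal_density"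
proof (cases "AE z in \<gamma>. x \<bullet> z = 0")
  case True
  then have "Q x \<bullet> x = (\<integral>z. 0 \<partial>\<gamma>)"
    unfolding Q_inner by (intro integral_cong_AE) auto
  then show ?thesis using True zero by simp
next
  case False
  then obtain \<sigma> where \<sigma>: "0 < \<sigma>"
    and D: "distributed \<gamma> lborel (\<lambda>z. x \<bullet> z) (\<lambda>t. ennreal (normal_density 0 \<sigma> t))"
    using gaussian unfolding centered_gaussian_def by blast
  have "variance (\<lambda>z. x \<bullet> z) = \<sigma>\<^sup>2"
    by (rule normal_distributed_variance[OF \<sigma> D])
  then have "Q x \<bullet> x = \<sigma>\<^sup>2"
    by (simp add: normal_distributed_expectation[OF \<sigma> D] Q_inner power2_eq_square)
  then show ?thesis
    using D \<sigma> normal_standard_normal_convert[OF \<sigma>, of "\<lambda>z. x \<bullet> z" 0] normal by simp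
qed

lemma distr_functional:
  assumes "0 < Q x \<bullet> x"
  shows "distr \<gamma> borel (\<lambda>z. x \<bullet> z / sqrt (Q x \<bullet> x)) = std_normal_distribution"
proof (cases x rule: functional_cases)
  case normal
  have "distr \<gamma> borel (\<lambda>z. x \<bullet> z / sqrt (Q x \<bullet> x)) = distr \<gamma> lborel (\<lambda>z. x \<bullet> z / sqrt (Q x \<bullet> x))"
    by (intro distr_cong) auto
  then show ?thesis
    using normal(2) by (simp add: distributed_def)
qed (use assms in simp)

lemma characteristic_functional:
  "(CLINT z|\<gamma>. iexp (x \<bullet> z)) = of_real (exp (- (Q x \<bullet> x) / 2))"
proof (cases x rule: functional_cases)
  case zero
  then have "(CLINT z|\<gamma>. iexp (x \<bullet> z)) = (CLINT z|\<gamma>. 1)"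
    by (intro integral_cong_AE) auto
  then show ?thesis using zero prob_space by simp
next
  case normal
  define \<sigma> where "\<sigma> = sqrt (Q x \<bullet> x)"
  have \<sigma>: "0 < \<sigma>" "\<sigma>\<^sup>2 = Q x \<bullet> x" using normal(1) by (simp_all add: \<sigma>_def)
  have "char (distr \<gamma> borel (\<lambda>z. x \<bullet> z / \<sigma>)) \<sigma> = of_real (exp (- (\<sigma>\<^sup>2) / 2))"
    using distr_functional[OF normal(1)] by (simp add: char_std_normal_distribution \<sigma>_def)
  moreover have "char (distr \<gamma> borel (\<lambda>z. x \<bullet> z / \<sigma>)) \<sigma> = (CLINT z|\<gamma>. iexp (x \<bullet> z))"
    unfolding char_def using \<sigma>(1) by (subst integral_distr) auto
  ultimately show ?thesis by (simp add: \<sigma>(2))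
qed

lemma integral_cos_functional: "(\<integral>z. cos (x \<bullet> z) \<partial>\<gamma>) = exp (- (Q x \<bullet> x) / 2)"
  and integral_sin_functional: "(\<integral>z. sin (x \<bullet> z) \<partial>\<gamma>) = 0"
proof -
  have int: "complex_integrable \<gamma> (\<lambda>z. iexp (x \<bullet> z))"
    by (intro integrable_iexp) auto
  show "(\<integral>z. cos (x \<bullet> z) \<partial>\<gamma>) = exp (- (Q x \<bullet> x) / 2)"
    using integral_Re[OF int] characteristic_functional[of x] by (simp flip: cis_conv_exp)
  show "(\<integral>z. sin (x \<bullet> z) \<partial>\<gamma>) = 0"
    using integral_Im[OF int] characteristic_functional[of x] by (simp flip: cis_conv_exp)
qed

end

text \<open>A density $W$ that leaves the characteristic function of $X$ unchanged leaves the law of $X$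
  unchanged, because a law on the line is determined by its characteristic function.\<close>

lemma (in prob_space) expectation_mult_indicator_of_char:
  fixes X W :: "'a \<Rightarrow> real"
  assumes X [measurable]: "X \<in> borel_measurable M" and W [measurable]: "W \<in> borel_measurable M"
    and W_bounds: "\<And>z. 0 \<le> W z" "\<And>z. W z \<le> K"
    and cos: "\<And>s. expectation (\<lambda>z. W z * cos (s * X z)) = expectation W * expectation (\<lambda>z. cos (s * X z))"
    and sin: "\<And>s. expectation (\<lambda>z. W z * sin (s * X z)) = expectation W * expectation (\<lambda>z. sin (s * X z))"
    and A [measurable]: "A \<in> sets borel"
  shows "expectation (\<lambda>z. W z * indicator A (X z)) = expectation W * expectation (\<lambda>z. indicator A (X z))"
proof -
  have int_W: "integrable M W"
    using W_bounds by (intro integrable_const_bound[where B = K]) auto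
  define w where "w = expectation W"
  have "0 \<le> w" unfolding w_def using W_bounds by simp
  show ?thesis
  proof (cases "w = 0")
    case True
    then have "AE z in M. W z = 0"
      using integral_nonneg_eq_0_iff_AE[OF int_W] W_bounds by (simp add: w_def)
    then have "expectation (\<lambda>z. W z * indicator A (X z)) = expectation (\<lambda>z. 0)"
      by (intro integral_cong_AE) auto
    then show ?thesis using True by (simp add: w_def)
  next
    case False
    with \<open>0 \<le> w\<close> have w: "0 < w" by simp
    define N where "N = density M (\<lambda>z. ennreal (W z / w))"
    have "emeasure N (space N) = 1"
    proof -
      have "emeasure N (space N) = (\<integral>\<^sup>+z. ennreal (W z / w) \<partial>M)"
        by (simp add: N_def emeasure_density cong: nn_integral_cong)
      also have "\<dots> = ennreal (expectation (\<lambda>z. W z / w))"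
        using int_W W_bounds w by (intro nn_integral_eq_integral) auto
      finally show ?thesis using w by (simp add: w_def)
    qed
    then interpret N: prob_space N by (intro prob_spaceI)
    have X_N [measurable]: "X \<in> borel_measurable N" by (simp add: N_def)
    have int_N: "(\<integral>z. f z \<partial>N) = expectation (\<lambda>z. W z * f z) / w"
      if [measurable]: "f \<in> borel_measurable M" for f :: "'a \<Rightarrow> real"
      unfolding N_def using W_bounds w by (subst integral_density) auto
    have char_eq: "char (distr L borel X) s = Complex (\<integral>z. cos (s * X z) \<partial>L) (\<integral>z. sin (s * X z) \<partial>L)"
      if "prob_space L" and [measurable]: "X \<in> borel_measurable L" for L s
    proof -
      interpret L: prob_space L by fact
      have int: "complex_integrable L (\<lambda>z. iexp (s * X z))"
        by (intro L.integrable_iexp) auto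
      have "char (distr L borel X) s = (CLINT z|L. iexp (s * X z))"
        unfolding char_def by (subst integral_distr) auto
      then show ?thesis
        using integral_Re[OF int] integral_Im[OF int]
        by (intro complex_eqI) (simp_all del: of_real_mult flip: cis_conv_exp)
    qed
    have "distr N borel X = distr M borel X"
    proof (rule Levy_uniqueness)
      show "real_distribution (distr N borel X)" by (rule N.real_distribution_distr) simp
      show "real_distribution (distr M borel X)" by (rule real_distribution_distr) simp
      show "char (distr N borel X) = char (distr M borel X)"
        using w by (intro ext) (simp add: char_eq[OF N.prob_space_axioms X_N]
            char_eq[OF prob_space_axioms X] int_N cos sin w_def)
    qed
    then have "(\<integral>t. indicator A t \<partial>distr N borel X) = (\<integral>t. indicator A t \<partial>distr M borel X :: real)"
      by simp
    then have "(\<integral>z. indicator A (X z) \<partial>N) = expectation (\<lambda>z. indicator A (X z) :: real)"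
      using integral_distr[OF X_N, of "indicat_real A"] integral_distr[OF X, of "indicat_real A"]
      by simp
    then have "expectation (\<lambda>z. W z * indicator A (X z)) / w = expectation (\<lambda>z. indicator A (X z))"
      by (simp add: int_N)
    then show ?thesis using w by (simp add: w_def field_simps)
  qed
qed

context gaussian_eigenbasis
begin

text \<open>The event $B$ carries no information about the coordinates from the $k$-th on: restricting
  $\gamma$ to $B$ merely scales the characteristic functional on the vectors orthogonal to
  $e_0, \dots, e_{k-1}$.\<close>

definition decoupled :: "nat \<Rightarrow> 'a set \<Rightarrow> bool" where
  "decoupled k B \<longleftrightarrow> B \<in> sets borel \<and> (\<forall>x. (\<forall>i<k. x \<bullet> e i = 0) \<longrightarrow>
     (\<integral>z. indicator B z * cos (x \<bullet> z) \<partial>\<gamma>) = prob B * exp (- (Q x \<bullet> x) / 2) \<and>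
     (\<integral>z. indicator B z * sin (x \<bullet> z) \<partial>\<gamma>) = 0)"

lemma decoupled_UNIV: "decoupled 0 UNIV"
  using prob_space by (simp add: decoupled_def integral_cos_functional integral_sin_functional)

text \<open>The weights $1_B$, $1_B(1 + \cos\langle y,\cdot\rangle)$ and
  $1_B(1 + \sin\langle y,\cdot\rangle)$ are nonnegative, and by the addition formulas none of them
  changes the characteristic function of $\langle e_k,\cdot\rangle$ when $y$ is orthogonal to
  $e_0, \dots, e_k$.  So all three integrate an event that depends on the $k$-th coordinate to the
  product of the integrals.\<close>

lemma decoupled_Suc:
  assumes B: "decoupled k B" and A [measurable]: "A \<in> sets borel"
  shows "prob (B \<inter> {z. e k \<bullet> z \<in> A}) = prob B * prob {z. e k \<bullet> z \<in> A}"
    and "decoupled (Suc k) (B \<inter> {z. e k \<bullet> z \<in> A})"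
proof -
  have B_meas [measurable]: "B \<in> sets \<gamma>" using B by (simp add: decoupled_def)
  have trig: "(\<integral>z. indicator B z * cos (x \<bullet> z) \<partial>\<gamma>) = prob B * exp (- (Q x \<bullet> x) / 2)"
    "(\<integral>z. indicator B z * sin (x \<bullet> z) \<partial>\<gamma>) = 0" if "\<And>i. i < k \<Longrightarrow> x \<bullet> e i = 0" for x
    using B that by (auto simp: decoupled_def)
  have int_bounded: "integrable \<gamma> f"
    if [measurable]: "f \<in> borel_measurable \<gamma>" and "\<And>z. \<bar>f z\<bar> \<le> 1" for f :: "'a \<Rightarrow> real"
    using that(2) by (intro integrable_const_bound[where B = 1]) auto
  have int_cos [simp]: "integrable \<gamma> (\<lambda>z. indicator B z * cos (x \<bullet> z))"
    and int_sin [simp]: "integrable \<gamma> (\<lambda>z. indicator B z * sin (x \<bullet> z))" for x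
    by (intro int_bounded; simp split: split_indicator)+
  have int_B [simp]: "integrable \<gamma> (indicat_real B)"
    by (intro int_bounded) (auto split: split_indicator)
  have X_cos: "(\<integral>z. cos (s * (e k \<bullet> z)) \<partial>\<gamma>) = exp (- (s\<^sup>2 * lam k) / 2)"
    and X_sin: "(\<integral>z. sin (s * (e k \<bullet> z)) \<partial>\<gamma>) = 0" for s
  proof -
    have "Q (s *\<^sub>R e k) \<bullet> (s *\<^sub>R e k) = s\<^sup>2 * lam k"
      by (simp add: Q_symmetric Q_basis basis_inner Q_coordinate power2_eq_square)
    then show "(\<integral>z. cos (s * (e k \<bullet> z)) \<partial>\<gamma>) = exp (- (s\<^sup>2 * lam k) / 2)"
      "(\<integral>z. sin (s * (e k \<bullet> z)) \<partial>\<gamma>) = 0"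
      using integral_cos_functional[of "s *\<^sub>R e k"] integral_sin_functional[of "s *\<^sub>R e k"] by simp_all
  qed
  define p where "p = (\<integral>z. indicator A (e k \<bullet> z) \<partial>\<gamma> :: real)"
  have p: "p = prob {z. e k \<bullet> z \<in> A}"
  proof -
    have "p = (\<integral>z. indicator {z. e k \<bullet> z \<in> A} z \<partial>\<gamma>)"
      unfolding p_def by (intro Bochner_Integration.integral_cong) (auto split: split_indicator)
    then show ?thesis by simp
  qed
  have weight: "(\<integral>z. (indicator B z * (1 + g (y \<bullet> z))) * indicator A (e k \<bullet> z) \<partial>\<gamma>) =
      (\<integral>z. indicator B z * (1 + g (y \<bullet> z)) \<partial>\<gamma>) * p"
    if y: "\<And>i. i < Suc k \<Longrightarrow> y \<bullet> e i = 0" and g: "g = cos \<or> g = sin" for y and g :: "real \<Rightarrow> real"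
  proof -
    have [measurable]: "g \<in> borel_measurable borel" using g by auto
    have g_bounds: "-1 \<le> g t" "g t \<le> 1" for t using g by auto
    have orth: "s *\<^sub>R e k \<bullet> e i = 0" "(s *\<^sub>R e k + y) \<bullet> e i = 0" "(s *\<^sub>R e k - y) \<bullet> e i = 0" "y \<bullet> e i = 0"
      if "i < k" for i s
      using that y[of i] by (simp_all add: inner_add_left inner_diff_left basis_inner)
    have Qk: "e k \<bullet> Q y = 0"
      using y[of k] by (subst inner_commute) (simp add: Q_coordinate)
    have Qadd: "Q (s *\<^sub>R e k + y) \<bullet> (s *\<^sub>R e k + y) = s\<^sup>2 * lam k + Q y \<bullet> y"
      "Q (s *\<^sub>R e k - y) \<bullet> (s *\<^sub>R e k - y) = s\<^sup>2 * lam k + Q y \<bullet> y"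
      "Q (s *\<^sub>R e k) \<bullet> (s *\<^sub>R e k) = s\<^sup>2 * lam k" for s
    proof -
      have *: "Q x \<bullet> (s *\<^sub>R e k + t *\<^sub>R y) = s * lam k * (x \<bullet> e k) + t * (Q x \<bullet> y)" for x t
        by (simp add: inner_add_right Q_coordinate mult.assoc)
      show "Q (s *\<^sub>R e k + y) \<bullet> (s *\<^sub>R e k + y) = s\<^sup>2 * lam k + Q y \<bullet> y"
        using *[of "s *\<^sub>R e k + y" 1] y[of k]
        by (simp add: inner_add_left basis_inner Qk Q_symmetric power2_eq_square)
      show "Q (s *\<^sub>R e k - y) \<bullet> (s *\<^sub>R e k - y) = s\<^sup>2 * lam k + Q y \<bullet> y"
        using *[of "s *\<^sub>R e k - y" "-1"] y[of k]
        by (simp add: inner_diff_left basis_inner Qk Q_symmetric power2_eq_square)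
      show "Q (s *\<^sub>R e k) \<bullet> (s *\<^sub>R e k) = s\<^sup>2 * lam k"
        using *[of "s *\<^sub>R e k" 0] by (simp add: basis_inner power2_eq_square mult.commute)
    qed
    define u where "u s = exp (- (s\<^sup>2 * lam k) / 2)" for s
    define v where "v = exp (- (Q y \<bullet> y) / 2)"
    have ek: "integrable \<gamma> (\<lambda>z. indicator B z * cos (s * (e k \<bullet> z)))"
      "integrable \<gamma> (\<lambda>z. indicator B z * sin (s * (e k \<bullet> z)))"
      "(\<integral>z. indicator B z * cos (s * (e k \<bullet> z)) \<partial>\<gamma>) = prob B * u s"
      "(\<integral>z. indicator B z * sin (s * (e k \<bullet> z)) \<partial>\<gamma>) = 0" for s
      using int_cos[of "s *\<^sub>R e k"] int_sin[of "s *\<^sub>R e k"] trig[OF orth(1), of s]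
      unfolding Qadd u_def by simp_all
    have exp_half: "exp (- (a + b) / 2) = exp (- a / 2) * exp (- b / 2)" for a b :: real
      by (simp add: field_simps flip: exp_add)
    note vals = ek trig[OF orth(4), folded v_def] trig(2)[OF orth(2)] trig(2)[OF orth(3)]
      trig(1)[OF orth(2), unfolded Qadd exp_half, folded u_def v_def]
      trig(1)[OF orth(3), unfolded Qadd exp_half, folded u_def v_def]
      X_cos[folded u_def] X_sin
    show ?thesis
      unfolding p_def
    proof (rule expectation_mult_indicator_of_char[where K = 2])
      show "0 \<le> indicator B z * (1 + g (y \<bullet> z))" "indicator B z * (1 + g (y \<bullet> z)) \<le> 2" for z
        using g_bounds[of "y \<bullet> z"] by (auto split: split_indicator)
    next
      fix s
      from g show "(\<integral>z. indicator B z * (1 + g (y \<bullet> z)) * cos (s * (e k \<bullet> z)) \<partial>\<gamma>) =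
        (\<integral>z. indicator B z * (1 + g (y \<bullet> z)) \<partial>\<gamma>) * (\<integral>z. cos (s * (e k \<bullet> z)) \<partial>\<gamma>)"
      proof
        assume g: "g = cos"
        have "(\<integral>z. indicator B z * (1 + g (y \<bullet> z)) * cos (s * (e k \<bullet> z)) \<partial>\<gamma>) =
          (\<integral>z. indicator B z * cos ((s *\<^sub>R e k) \<bullet> z) + (indicator B z * cos ((s *\<^sub>R e k + y) \<bullet> z) +
             indicator B z * cos ((s *\<^sub>R e k - y) \<bullet> z)) / 2 \<partial>\<gamma>)"
          by (intro Bochner_Integration.integral_cong)
            (auto simp: g inner_add_left inner_diff_left cos_add cos_diff distrib_right split: split_indicator)
        then show ?thesis
          by (simp add: vals g distrib_left) (simp add: algebra_simps)
      next
        assume g: "g = sin"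
        have "(\<integral>z. indicator B z * (1 + g (y \<bullet> z)) * cos (s * (e k \<bullet> z)) \<partial>\<gamma>) =
          (\<integral>z. indicator B z * cos ((s *\<^sub>R e k) \<bullet> z) + (indicator B z * sin ((s *\<^sub>R e k + y) \<bullet> z) -
             indicator B z * sin ((s *\<^sub>R e k - y) \<bullet> z)) / 2 \<partial>\<gamma>)"
          by (intro Bochner_Integration.integral_cong)
            (auto simp: g inner_add_left inner_diff_left sin_add sin_diff distrib_right split: split_indicator)
        then show ?thesis
          by (simp add: vals g distrib_left)
      qed
      from g show "(\<integral>z. indicator B z * (1 + g (y \<bullet> z)) * sin (s * (e k \<bullet> z)) \<partial>\<gamma>) =
        (\<integral>z. indicator B z * (1 + g (y \<bullet> z)) \<partial>\<gamma>) * (\<integral>z. sin (s * (e k \<bullet> z)) \<partial>\<gamma>)"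
      proof
        assume g: "g = cos"
        have "(\<integral>z. indicator B z * (1 + g (y \<bullet> z)) * sin (s * (e k \<bullet> z)) \<partial>\<gamma>) =
          (\<integral>z. indicator B z * sin ((s *\<^sub>R e k) \<bullet> z) + (indicator B z * sin ((s *\<^sub>R e k + y) \<bullet> z) +
             indicator B z * sin ((s *\<^sub>R e k - y) \<bullet> z)) / 2 \<partial>\<gamma>)"
          by (intro Bochner_Integration.integral_cong)
            (auto simp: g inner_add_left inner_diff_left sin_add sin_diff distrib_right split: split_indicator)
        then show ?thesis
          by (simp add: vals)
      next
        assume g: "g = sin"
        have "(\<integral>z. indicator B z * (1 + g (y \<bullet> z)) * sin (s * (e k \<bullet> z)) \<partial>\<gamma>) =
          (\<integral>z. indicator B z * sin ((s *\<^sub>R e k) \<bullet> z) + (indicator B z * cos ((s *\<^sub>R e k - y) \<bullet> z) -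
             indicator B z * cos ((s *\<^sub>R e k + y) \<bullet> z)) / 2 \<partial>\<gamma>)"
          by (intro Bochner_Integration.integral_cong)
            (auto simp: g inner_add_left inner_diff_left cos_add cos_diff distrib_right split: split_indicator)
        then show ?thesis
          by (simp add: vals)
      qed
    qed (use A in auto)
  qed
  let ?BA = "B \<inter> {z. e k \<bullet> z \<in> A}"
  have BA [measurable]: "?BA \<in> sets \<gamma>" by measurable
  have ind: "indicat_real ?BA z = indicator B z * indicator A (e k \<bullet> z)" for z
    by (auto split: split_indicator)
  have int_BA [simp]: "integrable \<gamma> (\<lambda>z. indicator B z * indicator A (e k \<bullet> z) :: real)"
    "integrable \<gamma> (\<lambda>z. indicator B z * indicator A (e k \<bullet> z) * cos (y \<bullet> z))"
    "integrable \<gamma> (\<lambda>z. indicator B z * indicator A (e k \<bullet> z) * sin (y \<bullet> z))" for y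
    by (intro int_bounded; simp split: split_indicator)+
  \<comment> \<open>the weight $1_B$ is $1_B(1 + \sin 0)$\<close>
  have prob_BA: "(\<integral>z. indicator B z * indicator A (e k \<bullet> z) \<partial>\<gamma>) = prob B * p"
    using weight[of 0 sin] by simp
  show "prob ?BA = prob B * prob {z. e k \<bullet> z \<in> A}"
    unfolding p[symmetric] prob_BA[symmetric] ind[symmetric] by simp
  have "(\<integral>z. indicator ?BA z * cos (y \<bullet> z) \<partial>\<gamma>) = prob ?BA * exp (- (Q y \<bullet> y) / 2)"
    "(\<integral>z. indicator ?BA z * sin (y \<bullet> z) \<partial>\<gamma>) = 0" if y: "\<forall>i<Suc k. y \<bullet> e i = 0" for y
  proof -
    have prob: "prob ?BA = prob B * p" using p \<open>prob ?BA = _\<close> by simp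
    have "(\<integral>z. indicator B z * indicator A (e k \<bullet> z) + indicator B z * indicator A (e k \<bullet> z) * cos (y \<bullet> z) \<partial>\<gamma>) =
      (\<integral>z. indicator B z + indicator B z * cos (y \<bullet> z) \<partial>\<gamma>) * p"
      using weight[of y cos] y by (simp add: algebra_simps)
    then have "prob B * p + (\<integral>z. indicator B z * indicator A (e k \<bullet> z) * cos (y \<bullet> z) \<partial>\<gamma>) =
      (prob B + prob B * exp (- (Q y \<bullet> y) / 2)) * p"
      using y by (simp add: prob_BA trig)
    then show "(\<integral>z. indicator ?BA z * cos (y \<bullet> z) \<partial>\<gamma>) = prob ?BA * exp (- (Q y \<bullet> y) / 2)"
      unfolding ind by (simp add: prob algebra_simps)
    have "(\<integral>z. indicator B z * indicator A (e k \<bullet> z) + indicator B z * indicator A (e k \<bullet> z) * sin (y \<bullet> z) \<partial>\<gamma>) =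
      (\<integral>z. indicator B z + indicator B z * sin (y \<bullet> z) \<partial>\<gamma>) * p"
      using weight[of y sin] y by (simp add: algebra_simps)
    then show "(\<integral>z. indicator ?BA z * sin (y \<bullet> z) \<partial>\<gamma>) = 0"
      unfolding ind using y by (simp add: prob_BA trig)
  qed
  then show "decoupled (Suc k) ?BA"
    using BA by (simp add: decoupled_def)
qed

lemma prob_coordinates:
  assumes A: "\<And>i. A i \<in> sets borel"
  shows "decoupled k (\<Inter>i<k. {z. e i \<bullet> z \<in> A i}) \<and>
    prob (\<Inter>i<k. {z. e i \<bullet> z \<in> A i}) = (\<Prod>i<k. prob {z. e i \<bullet> z \<in> A i})"
proof (induction k)
  case 0
  then show ?case using prob_space by (simp add: decoupled_UNIV)
next
  case (Suc k)
  have eq: "(\<Inter>i<Suc k. {z. e i \<bullet> z \<in> A i}) = (\<Inter>i<k. {z. e i \<bullet> z \<in> A i}) \<inter> {z. e k \<bullet> z \<in> A k}"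
    by (auto simp: less_Suc_eq)
  show ?case
    unfolding eq using decoupled_Suc[OF _ A] Suc by simp
qed

lemma distr_h_hat: "distr \<gamma> borel (h_hat e lam j) = std_normal_distribution"
proof -
  have "Q (e j) \<bullet> e j = lam j" by (simp add: Q_basis basis_inner)
  then show ?thesis
    using distr_functional[of "e j"] lam_pos[of j]
    by (simp add: h_hat_def[abs_def] inner_commute)
qed

lemma h_hat_measurable [measurable]: "h_hat e lam j \<in> borel_measurable \<gamma>"
  unfolding h_hat_def[abs_def] by (subst inner_commute) measurable

text \<open>A finite family of coordinates is completed to an initial segment by the sure event.\<close>

lemma indep_h_hat: "indep_vars (\<lambda>_. borel) (h_hat e lam) UNIV"
  unfolding indep_vars_def2
proof (intro conjI ballI indep_setsI)
  fix S :: "nat \<Rightarrow> 'a set" and J :: "nat set"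
  assume J: "finite J" and S: "\<forall>j\<in>J. S j \<in> {h_hat e lam j -` A \<inter> space \<gamma> |A. A \<in> sets borel}"
  then have "\<forall>j. \<exists>A. A \<in> sets borel \<and> (if j \<in> J then S j else UNIV) = h_hat e lam j -` A"
    by (auto intro: exI[of _ UNIV])
  then obtain A where A: "\<And>j. A j \<in> sets borel" "\<And>j. (if j \<in> J then S j else UNIV) = h_hat e lam j -` A j"
    by metis
  obtain n where n: "J \<subseteq> {..<n}"
    using J finite_nat_bounded by blast
  define A' where "A' j = (\<lambda>t. t / sqrt (lam j)) -` A j" for j
  have A': "A' j \<in> sets borel" for j
    unfolding A'_def using A(1)[of j] by (intro measurable_sets_borel) auto
  have S_eq: "{z. e j \<bullet> z \<in> A' j} = (if j \<in> J then S j else UNIV)" for j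
    by (subst A(2)) (auto simp: A'_def h_hat_def inner_commute)
  have "(\<Inter>j\<in>J. S j) = (\<Inter>j<n. {z. e j \<bullet> z \<in> A' j})"
    using n unfolding S_eq by auto
  then have "prob (\<Inter>j\<in>J. S j) = (\<Prod>j<n. prob {z. e j \<bullet> z \<in> A' j})"
    using prob_coordinates[OF A'] by simp
  also have "\<dots> = (\<Prod>j<n. if j \<in> J then prob (S j) else 1)"
    using prob_space by (intro prod.cong) (auto simp: S_eq)
  also have "\<dots> = (\<Prod>j\<in>J. prob (S j))"
    using n by (simp add: prod.If_cases Int_absorb1)
  finally show "prob (\<Inter>j\<in>J. S j) = (\<Prod>j\<in>J. prob (S j))" .
qed (use measurable_sets[OF h_hat_measurable] in auto)

lemma integral_prod_h_hat:
  fixes f :: "nat \<Rightarrow> real \<Rightarrow> real"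
  assumes "finite J" and [measurable]: "\<And>j. f j \<in> borel_measurable borel"
    and bounded: "\<And>j t. j \<in> J \<Longrightarrow> \<bar>f j t\<bar> \<le> B j"
  shows "(\<integral>z. (\<Prod>j\<in>J. f j (h_hat e lam j z)) \<partial>\<gamma>) = (\<Prod>j\<in>J. \<integral>t. f j t \<partial>std_normal_distribution)"
proof -
  have "indep_vars (\<lambda>_. borel) (\<lambda>j. f j \<circ> h_hat e lam j) J"
    by (rule indep_vars_compose[OF indep_vars_subset[OF indep_h_hat]]) auto
  moreover have "integrable \<gamma> (f j \<circ> h_hat e lam j)" if "j \<in> J" for j
    using bounded[OF that] by (intro integrable_const_bound[where B = "B j"]) auto
  ultimately have "(\<integral>z. (\<Prod>j\<in>J. (f j \<circ> h_hat e lam j) z) \<partial>\<gamma>) = (\<Prod>j\<in>J. \<integral>z. (f j \<circ> h_hat e lam j) z \<partial>\<gamma>)"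
    using \<open>finite J\<close> by (intro indep_vars_lebesgue_integral)
  moreover have "(\<integral>z. (f j \<circ> h_hat e lam j) z \<partial>\<gamma>) = (\<integral>t. f j t \<partial>std_normal_distribution)" for j
    unfolding distr_h_hat[of j, symmetric] by (simp add: integral_distr)
  ultimately show ?thesis by simp
qed

end

section \<open>A smooth step and the Gaussian tail\<close>

text \<open>The step function is $r^2/(1 + r^2)$ with $r = \max(0, c(t - c) + 1)$: for $c > 0$ it
  vanishes up to $c - 1/c$ and equals $1/2$ at $c$.  A layer of width $1/c$ below the level $c$ is thin enough for
  the Gaussian density to vary by a bounded factor only.\<close>

definition smooth_step :: "real \<Rightarrow> real \<Rightarrow> real" where
  "smooth_step c t = (max 0 (c * (t - c) + 1))\<^sup>2 / (1 + (max 0 (c * (t - c) + 1))\<^sup>2)"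

definition smooth_step_deriv :: "real \<Rightarrow> real \<Rightarrow> real" where
  "smooth_step_deriv c t = 2 * c * max 0 (c * (t - c) + 1) / (1 + (max 0 (c * (t - c) + 1))\<^sup>2)\<^sup>2"

lemma DERIV_max_0_square: "((\<lambda>t::real. (max 0 t)\<^sup>2) has_field_derivative 2 * max 0 t) (at t)"
proof (cases t "0 :: real" rule: linorder_cases)
  case less
  have "((\<lambda>t::real. 0) has_field_derivative 0) (at t)" by simp
  then show ?thesis
    by (rule has_field_derivative_transform_within_open[where S = "{..<0}", THEN DERIV_cong])
      (use less in auto)
next
  case equal
  have "(\<lambda>h::real. max 0 h) \<midarrow>0\<rightarrow> 0"
    using tendsto_max[OF tendsto_const tendsto_ident_at, of 0 "0 :: real" UNIV] by simp
  then have "(\<lambda>h::real. (max 0 h)\<^sup>2 / h) \<midarrow>0\<rightarrow> 0"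
    by (rule Lim_transform_eventually)
      (auto simp: eventually_at_filter max_def power2_eq_square intro!: always_eventually)
  then show ?thesis using equal by (simp add: DERIV_def)
next
  case greater
  have "((\<lambda>t::real. t\<^sup>2) has_field_derivative 2 * t) (at t)"
    by (auto intro!: derivative_eq_intros)
  then show ?thesis
    by (rule has_field_derivative_transform_within_open[where S = "{0<..}", THEN DERIV_cong])
      (use greater in auto)
qed

lemma one_plus_square_pos [simp]: "0 < 1 + (x::real)\<^sup>2" "1 + x\<^sup>2 \<noteq> 0"
  by (smt (verit) zero_le_power2)+

lemma DERIV_smooth_step: "(smooth_step c has_field_derivative smooth_step_deriv c t) (at t)"
proof -
  let ?w = "\<lambda>t. (max 0 (c * (t - c) + 1))\<^sup>2" and ?D = "2 * max 0 (c * (t - c) + 1) * c"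
  have w: "(?w has_field_derivative ?D) (at t)"
    by (rule DERIV_chain2[OF DERIV_max_0_square]) (auto intro!: derivative_eq_intros)
  have "((\<lambda>t. ?w t / (1 + ?w t)) has_field_derivative
      (?D * (1 + ?w t) - ?w t * (0 + ?D)) / ((1 + ?w t) * (1 + ?w t))) (at t)"
    by (intro DERIV_divide DERIV_add DERIV_const w) simp
  then show ?thesis
    unfolding smooth_step_def[abs_def]
    by (rule DERIV_cong) (simp add: smooth_step_deriv_def power2_eq_square[of "1 + _"] algebra_simps)
qed

lemma smooth_step_nonneg: "0 \<le> smooth_step c t" and smooth_step_le_1: "smooth_step c t \<le> 1"
  by (simp_all add: smooth_step_def)

lemma smooth_step_eq_0: "c * (t - c) + 1 \<le> 0 \<Longrightarrow> smooth_step c t = 0"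
  by (simp add: smooth_step_def max_def)

lemma smooth_step_self: "smooth_step c c = 1 / 2"
  by (simp add: smooth_step_def)

lemma continuous_smooth_step [continuous_intros]: "continuous_on A (smooth_step c)"
  unfolding smooth_step_def[abs_def] by (intro continuous_intros) auto

lemma continuous_smooth_step_deriv [continuous_intros]: "continuous_on A (smooth_step_deriv c)"
  unfolding smooth_step_deriv_def[abs_def] by (intro continuous_intros) auto

lemma smooth_step_measurable [measurable]: "smooth_step c \<in> borel_measurable borel"
  and smooth_step_deriv_measurable [measurable]: "smooth_step_deriv c \<in> borel_measurable borel"
  by (intro borel_measurable_continuous_onI continuous_intros)+

lemma smooth_step_deriv_bounded:
  assumes "0 \<le> c" shows "\<bar>smooth_step_deriv c t\<bar> \<le> 2 * c"
proof -
  define r where "r = max 0 (c * (t - c) + 1)"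
  have "0 \<le> r" by (simp add: r_def)
  have "r \<le> 1 + r\<^sup>2" using zero_le_power2[of "r - 1 / 2"] by (simp add: power2_diff power_divide)
  also have "\<dots> \<le> (1 + r\<^sup>2)\<^sup>2" by (rule self_le_power) auto
  finally have "r / (1 + r\<^sup>2)\<^sup>2 \<le> 1" by simp
  then have "2 * c * (r / (1 + r\<^sup>2)\<^sup>2) \<le> 2 * c * 1"
    using assms by (intro mult_left_mono) auto
  then show ?thesis
    using assms \<open>0 \<le> r\<close> by (simp add: smooth_step_deriv_def flip: r_def)
qed

text \<open>On $[b, \infty)$ the density $\varphi(t)$ is at most $(t/b)\,\varphi(t)$, which has the
  explicit primitive $-\varphi(t)/b$; the factor $1/2$ bounds $1/\sqrt{2\pi}$.\<close>

lemma emeasure_std_normal_atLeast: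
  assumes "0 < b"
  shows "emeasure std_normal_distribution {b..} \<le> ennreal (exp (- b\<^sup>2 / 2) / (2 * b))"
proof -
  let ?F = "\<lambda>t::real. - exp (- t\<^sup>2 / 2) / (2 * b)"
  have "emeasure std_normal_distribution {b..} =
      (\<integral>\<^sup>+t. ennreal (std_normal_density t) * indicator {b..} t \<partial>lborel)"
    by (simp add: emeasure_density)
  also have "\<dots> \<le> (\<integral>\<^sup>+t. ennreal (t * exp (- t\<^sup>2 / 2) / (2 * b)) * indicator {b..} t \<partial>lborel)"
  proof (rule nn_integral_mono)
    fix t :: real
    have "std_normal_density t \<le> t * exp (- t\<^sup>2 / 2) / (2 * b)" if "b \<le> t"
    proof -
      have "sqrt 4 \<le> sqrt (2 * pi)"
        using pi_gt3 by (intro real_sqrt_le_mono) linarith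
      then have "std_normal_density t \<le> exp (- t\<^sup>2 / 2) / 2"
        unfolding std_normal_density_def by (simp add: field_simps)
      also have "\<dots> = b * exp (- t\<^sup>2 / 2) / (2 * b)" using assms by simp
      also have "\<dots> \<le> t * exp (- t\<^sup>2 / 2) / (2 * b)"
        using that assms by (intro divide_right_mono mult_right_mono) auto
      finally show ?thesis .
    qed
    then show "ennreal (std_normal_density t) * indicator {b..} t \<le>
        ennreal (t * exp (- t\<^sup>2 / 2) / (2 * b)) * indicator {b..} t"
      by (auto split: split_indicator intro!: ennreal_leI)
  qed
  also have "\<dots> = ennreal (0 - ?F b)"
  proof (rule nn_integral_FTC_atLeast[where F = ?F])
    show "((\<lambda>t. - exp (- t\<^sup>2 / 2) / (2 * b)) \<longlongrightarrow> 0) at_top"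
      using assms by real_asymp
  qed (use assms in \<open>auto intro!: derivative_eq_intros\<close>)
  finally show ?thesis by simp
qed

lemma prob_space_std_normal: "prob_space std_normal_distribution"
  using real_dist_normal_dist by (simp add: real_distribution_def)

lemma integrable_std_normal_bounded:
  assumes "f \<in> borel_measurable borel" and "\<And>t. \<bar>f t\<bar> \<le> B"
  shows "integrable std_normal_distribution (f :: real \<Rightarrow> real)"
proof -
  interpret prob_space std_normal_distribution by (rule prob_space_std_normal)
  show ?thesis using assms by (intro integrable_const_bound[where B = B]) auto
qed

lemma measure_std_normal_Icc:
  assumes "0 < b"
  shows "1 - exp (- b\<^sup>2 / 2) / b \<le> measure std_normal_distribution {-b..b}"
proof -
  interpret prob_space std_normal_distribution by (rule prob_space_std_normal)
  have right: "prob {b..} \<le> exp (- b\<^sup>2 / 2) / (2 * b)"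
    using emeasure_std_normal_atLeast[OF assms] assms by (simp add: emeasure_eq_measure)
  have "emeasure std_normal_distribution {..-b} = emeasure (distr std_normal_distribution borel uminus) {b..}"
    by (subst emeasure_distr) (auto intro!: arg_cong[where f = "emeasure _"])
  also have "distr std_normal_distribution borel uminus = std_normal_distribution"
  proof -
    have "distr std_normal_distribution borel uminus = distr std_normal_distribution lborel (\<lambda>t. 0 + -1 * t)"
      by (intro distr_cong) auto
    also have "\<dots> = std_normal_distribution"
      using normal_density_affine[where X = "\<lambda>t. t" and \<mu> = 0 and \<sigma> = 1 and \<alpha> = "-1" and \<beta> = 0]
      by (simp add: distributed_def distr_id2 cong: distr_cong)
    finally show ?thesis .
  qed
  finally have left: "prob {..-b} \<le> exp (- b\<^sup>2 / 2) / (2 * b)"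
    using right by (simp add: emeasure_eq_measure)
  have "1 = prob ({..-b} \<union> {-b..b} \<union> {b..})"
    using assms prob_space by (intro arg_cong2[where f = measure] trans[OF prob_space[symmetric]]) auto
  also have "\<dots> \<le> prob {..-b} + prob {-b..b} + prob {b..}"
    by (intro order_trans[OF measure_Un_le] add_right_mono measure_Un_le) auto
  finally show ?thesis using left right by (simp add: field_simps)
qed

text \<open>The integrand is $1$ on $[-b, b]$ with $b = c - 1/c$.  As $b^2 \ge c^2 - 2$, moving from $c$
  down to $b$ costs a factor $e \le 3$ in the exponential and, as $b \ge c/2$, a factor $2$ in the
  denominator of the tail bound.\<close>

lemma integral_one_minus_smooth_step:
  assumes c: "2 \<le> c"
  shows "1 - 6 * exp (- c\<^sup>2 / 2) / c \<le> (\<integral>t. indicator {-c..c} t * (1 - smooth_step c t) \<partial>std_normal_distribution)"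
proof -
  interpret prob_space std_normal_distribution by (rule prob_space_std_normal)
  define b where "b = c - 1 / c"
  have "2 * 2 \<le> c * c" using c by (intro mult_mono) auto
  then have "1 / c \<le> c / 4" using c by (simp add: divide_simps)
  then have b: "c / 2 \<le> b" "0 < b" "b \<le> c" using c by (auto simp: b_def)
  have "c\<^sup>2 - 2 \<le> b\<^sup>2"
    using c by (simp add: b_def power2_diff)
  then have "exp (- b\<^sup>2 / 2) \<le> exp (1 + - c\<^sup>2 / 2)" by simp
  also have "\<dots> \<le> 3 * exp (- c\<^sup>2 / 2)" using exp_le by (simp only: exp_add) simp
  finally have "exp (- b\<^sup>2 / 2) / b \<le> 3 * exp (- c\<^sup>2 / 2) / (c / 2)"
    using b c by (intro frac_le) auto
  then have "1 - 6 * exp (- c\<^sup>2 / 2) / c \<le> prob {-b..b}"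
    using measure_std_normal_Icc[OF b(2)] by simp
  also have "\<dots> = (\<integral>t. indicator {-b..b} t \<partial>std_normal_distribution)" by simp
  also have "\<dots> \<le> (\<integral>t. indicator {-c..c} t * (1 - smooth_step c t) \<partial>std_normal_distribution)"
  proof (rule integral_mono)
    fix t :: real
    show "indicator {-b..b} t \<le> indicator {-c..c} t * (1 - smooth_step c t)"
    proof (cases "t \<in> {-b..b}")
      case True
      then have "c * (t - c) + 1 \<le> c * (b - c) + 1"
        using c by (intro add_right_mono mult_left_mono) auto
      also have "\<dots> = 0" using c by (simp add: b_def algebra_simps)
      finally have "smooth_step c t = 0" by (rule smooth_step_eq_0)
      then show ?thesis using True b by (auto split: split_indicator)
    next
      case False
      then show ?thesis using smooth_step_le_1[of c t] by (auto split: split_indicator)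
    qed
  next
    show "integrable std_normal_distribution (\<lambda>t. indicator {-c..c} t * (1 - smooth_step c t))"
    proof (rule integrable_std_normal_bounded)
      show "\<bar>indicator {-c..c} t * (1 - smooth_step c t)\<bar> \<le> 1" for t
        using smooth_step_nonneg[of c t] smooth_step_le_1[of c t] by (auto split: split_indicator)
    qed simp
  qed (auto intro!: integrable_std_normal_bounded[where B = 1])
  finally show ?thesis .
qed

lemma DERIV_std_normal_density:
  "(std_normal_density has_field_derivative - t * std_normal_density t) (at t)"
proof -
  define C where "C = 1 / sqrt (2 * pi)"
  have "std_normal_density = (\<lambda>t. C * exp (- t\<^sup>2 / 2))"
    by (simp add: std_normal_density_def[abs_def] C_def)
  then show ?thesis by (auto intro!: derivative_eq_intros)
qed

text \<open>The one-dimensional divergence theorem: $\psi' - t\psi$ times the Gaussian density is the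
  derivative of $\psi$ times the density, so only the boundary value at $c$ survives.\<close>

lemma integral_gauss_div_smooth_step:
  assumes c: "2 \<le> c"
  shows "(\<integral>t. indicator {-c..c} t * (smooth_step_deriv c t - t * smooth_step c t) \<partial>std_normal_distribution) =
    std_normal_density c / 2"
proof -
  have deriv: "((\<lambda>t. smooth_step c t * std_normal_density t) has_field_derivative
      std_normal_density t * (smooth_step_deriv c t - t * smooth_step c t)) (at t)" for t
    by (rule DERIV_cong[OF DERIV_mult[OF DERIV_smooth_step DERIV_std_normal_density]])
      (simp add: algebra_simps)
  have cont: "continuous_on A std_normal_density" for A
    by (intro continuous_at_imp_continuous_on ballI DERIV_isCont[OF DERIV_std_normal_density])
  have "(\<integral>t. indicator {-c..c} t * (smooth_step_deriv c t - t * smooth_step c t) \<partial>std_normal_distribution) =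
      (\<integral>t. indicator {-c..c} t *\<^sub>R (std_normal_density t * (smooth_step_deriv c t - t * smooth_step c t)) \<partial>lborel)"
    by (subst integral_density) (auto simp: mult.left_commute)
  also have "\<dots> = smooth_step c c * std_normal_density c - smooth_step c (-c) * std_normal_density (-c)"
  proof (rule integral_FTC_atLeastAtMost)
    show "((\<lambda>t. smooth_step c t * std_normal_density t) has_vector_derivative
        std_normal_density t * (smooth_step_deriv c t - t * smooth_step c t)) (at t within {-c..c})" for t
      by (rule has_field_derivative_at_within[OF deriv,
            unfolded has_real_derivative_iff_has_vector_derivative])
    show "continuous_on {-c..c} (\<lambda>t. std_normal_density t * (smooth_step_deriv c t - t * smooth_step c t))"
      by (intro continuous_on_mult continuous_on_diff continuous_on_id continuous_smooth_step
          continuous_smooth_step_deriv cont)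
  qed (use c in simp)
  also have "smooth_step c (-c) = 0"
  proof (rule smooth_step_eq_0)
    have "2 * 2 \<le> c * c" using c by (intro mult_mono) auto
    then show "c * (- c - c) + 1 \<le> 0" by (simp add: algebra_simps)
  qed
  finally show ?thesis by (simp add: smooth_step_self)
qed

section \<open>The choice of the side lengths\<close>

lemma not_summable_inverse_n_log_n: "\<not> summable (\<lambda>n. 1 / (real (n + 1) * ln (real (n + 1))))"
  and summable_inverse_n_log_n_sqrt_log_n:
    "summable (\<lambda>n. 1 / (real (n + 1) * ln (real (n + 1)) * sqrt (ln (real (n + 1)))))"
proof -
  let ?L = "\<lambda>n. ln (real (n + 1))"
  let ?f = "\<lambda>n. 1 / (real (n + 1) * ?L n)" and ?g = "\<lambda>n. 1 / (real (n + 1) * ?L n * sqrt (?L n))"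
  have L: "0 < ?L n" if "0 < n" for n using that by simp
  \<comment> \<open>Cauchy condensation turns the two series into the harmonic one and the one with exponent $3/2$\<close>
  have "\<not> summable (\<lambda>n. 2 ^ n * ?f (2 ^ n))"
  proof
    assume "summable (\<lambda>n. 2 ^ n * ?f (2 ^ n))"
    then have "summable (\<lambda>n. inverse (real (Suc n)))"
    proof (rule summable_comparison_test'[OF summable_mult[of _ 2]])
      fix n :: nat
      have "?L (2 ^ n) \<le> ln (2 ^ Suc n)" by (subst ln_le_cancel_iff) (auto simp: add_pos_pos)
      also have "\<dots> = real (Suc n) * ln 2" by (simp only: ln_realpow)
      also have "\<dots> \<le> real (Suc n) * 1" using ln_2_less_1 by (intro mult_left_mono) auto
      finally have le: "?L (2 ^ n) \<le> real (Suc n)" by simp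
      have "real (2 ^ n + 1) * ?L (2 ^ n) \<le> (2 * 2 ^ n) * real (Suc n)"
        by (intro mult_mono le) (use one_le_power[of "2::real" n] in auto)
      then have "1 / ((2 * 2 ^ n) * real (Suc n)) \<le> ?f (2 ^ n)"
        using L[of "2 ^ n"] by (intro frac_le mult_pos_pos) (auto simp: add_pos_pos)
      then have "2 * 2 ^ n * (1 / ((2 * 2 ^ n) * real (Suc n))) \<le> 2 * 2 ^ n * ?f (2 ^ n)"
        by (rule mult_left_mono) auto
      moreover have "2 * 2 ^ n * (1 / ((2 * 2 ^ n) * real (Suc n))) = inverse (real (Suc n))"
        by (simp add: inverse_eq_divide)
      ultimately show "norm (inverse (real (Suc n))) \<le> 2 * (2 ^ n * ?f (2 ^ n))"
        by simp
    qed
    then show False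
      using not_summable_harmonic[where 'a = real] summable_Suc_iff[of "\<lambda>n. inverse (real n)"] by simp
  qed
  then show "\<not> summable ?f"
    by (subst condensation_test) (auto intro!: frac_le mult_mono mult_pos_pos)
  have "summable (\<lambda>n. 2 ^ n * ?g (2 ^ n))"
  proof (rule summable_comparison_test')
    show "summable (\<lambda>n. (1 / (ln 2 * sqrt (ln 2))) * real n powr (- 3 / 2))"
      by (intro summable_mult) (simp add: summable_real_powr_iff)
    fix n :: nat assume n: "1 \<le> n"
    define l where "l = real n * ln 2"
    have l: "0 < l" using n by (simp add: l_def)
    have "ln (2 ^ n) \<le> ?L (2 ^ n)" by (subst ln_le_cancel_iff) (auto simp: add_pos_pos)
    then have le: "l \<le> ?L (2 ^ n)" by (simp add: l_def ln_realpow)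
    have "2 ^ n * l * sqrt l \<le> real (2 ^ n + 1) * ?L (2 ^ n) * sqrt (?L (2 ^ n))"
      using l le by (intro mult_mono) auto
    then have "2 ^ n * ?g (2 ^ n) \<le> 2 ^ n * (1 / (2 ^ n * l * sqrt l))"
      using l le by (intro mult_left_mono frac_le mult_pos_pos) auto
    also have "\<dots> = 1 / (l * sqrt l)" using l by simp
    also have "\<dots> = (1 / (ln 2 * sqrt (ln 2))) * (1 / (real n * sqrt (real n)))"
      by (simp add: l_def real_sqrt_mult)
    also have "1 / (real n * sqrt (real n)) = real n powr (- 3 / 2)"
    proof -
      have "real n * sqrt (real n) = real n powr (1 + 1 / 2)"
        using n by (subst powr_add) (simp add: powr_half_sqrt)
      then show ?thesis by (simp add: powr_minus_divide)
    qed
    finally show "norm (2 ^ n * ?g (2 ^ n)) \<le> (1 / (ln 2 * sqrt (ln 2))) * real n powr (- 3 / 2)"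
      using le l by simp
  qed
  then show "summable ?g"
    by (subst condensation_test) (auto intro!: frac_le mult_mono mult_pos_pos)
qed

text \<open>Up to constants, $e^{-c_j^2/2}$ is the Gaussian perimeter of the half-space bounded by the
  $j$-th face and $e^{-c_j^2/2}/c_j$ is the mass beyond it.  The extra factor $1/c_j$ separates
  divergence from convergence: $e^{-c_j^2/2} = 1/(n \log n)$ with $n = j + J + 1$.\<close>

lemma obtain_side_lengths:
  obtains c :: "nat \<Rightarrow> real" and K :: real where
    "\<And>j. 2 \<le> c j"
    "\<not> summable (\<lambda>j. exp (- (c j)\<^sup>2 / 2))"
    "\<And>A. finite A \<Longrightarrow> (\<Sum>j\<in>A. 6 * exp (- (c j)\<^sup>2 / 2) / c j) \<le> 1 / 2"
    "\<And>j. 1 \<le> j \<Longrightarrow> (c j)\<^sup>2 \<le> K * ln (real (Suc j))"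
proof -
  let ?L = "\<lambda>n. ln (real (n + 1))"
  let ?f = "\<lambda>n. 1 / (real (n + 1) * ?L n)" and ?g = "\<lambda>n. 1 / (real (n + 1) * ?L n * sqrt (?L n))"
  have g: "summable ?g" by (rule summable_inverse_n_log_n_sqrt_log_n)
  then obtain J0 where J0: "\<And>n. J0 \<le> n \<Longrightarrow> norm (\<Sum>i. ?g (i + n)) < 1 / 12"
    using suminf_exist_split[of "1 / 12" ?g] by auto
  \<comment> \<open>$15 + 1 > e^2$, so $\log(j + J + 1) \ge 2$ for all $j$, and hence $c_j \ge 2$\<close>
  define J where "J = max J0 15"
  define c where "c j = sqrt (2 * ln (real (j + J + 1) * ?L (j + J)))" for j
  have L2: "2 \<le> ?L (j + J)" for j
  proof -
    have "exp 2 = exp 1 * (exp 1 :: real)" by (simp flip: exp_add)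
    also have "\<dots> \<le> 3 * 3" using exp_le by (intro mult_mono) auto
    also have "\<dots> \<le> real (j + J + 1)" by (simp add: J_def)
    finally show ?thesis by (simp add: ln_ge_iff)
  qed
  have pos: "0 < real (j + J + 1) * ?L (j + J)" for j
    by (rule mult_pos_pos[OF _ less_le_trans[OF _ L2]]) simp_all
  have log: "ln (real (j + J + 1) * ?L (j + J)) = ?L (j + J) + ln (?L (j + J))" for j
    using L2[of j] by (intro ln_mult_pos less_le_trans[OF _ L2]) simp_all
  have lnL: "0 \<le> ln (?L (j + J))" for j using L2[of j] by simp
  have c_sq: "(c j)\<^sup>2 = 2 * ln (real (j + J + 1) * ?L (j + J))" for j
    unfolding c_def log using L2[of j] lnL[of j] by simp
  have exp_c: "exp (- (c j)\<^sup>2 / 2) = ?f (j + J)" for j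
    unfolding c_sq using pos[of j] by (simp add: exp_minus inverse_eq_divide)
  have c_ge: "sqrt (2 * ?L (j + J)) \<le> c j" for j
    unfolding c_def log using lnL[of j] by simp
  have c2: "2 \<le> c j" for j
  proof -
    have "sqrt (2 * 2) \<le> sqrt (2 * ?L (j + J))" using L2[of j] by (intro real_sqrt_le_mono) linarith
    then show ?thesis using c_ge[of j] by simp
  qed
  have term_le: "6 * exp (- (c j)\<^sup>2 / 2) / c j \<le> 6 * ?g (j + J)" for j
  proof -
    have "sqrt (?L (j + J)) \<le> c j"
      using c_ge[of j] L2[of j] by (smt (verit) real_sqrt_le_mono)
    moreover have "0 < sqrt (?L (j + J))"
      unfolding real_sqrt_gt_0_iff using L2[of j] by linarith
    ultimately have "?f (j + J) / c j \<le> ?f (j + J) / sqrt (?L (j + J))"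
      by (intro frac_le) simp_all
    then show ?thesis unfolding exp_c by simp
  qed
  have nonneg: "0 \<le> ?g (j + J)" for j using L2[of j] by simp
  show ?thesis
  proof
    show "2 \<le> c j" for j by (rule c2)
    show "\<not> summable (\<lambda>j. exp (- (c j)\<^sup>2 / 2))"
      unfolding exp_c using not_summable_inverse_n_log_n summable_iff_shift[of ?f J] by simp
    show "(\<Sum>j\<in>A. 6 * exp (- (c j)\<^sup>2 / 2) / c j) \<le> 1 / 2" if "finite A" for A
    proof -
      have "(\<Sum>j\<in>A. 6 * exp (- (c j)\<^sup>2 / 2) / c j) \<le> (\<Sum>j\<in>A. 6 * ?g (j + J))"
        by (intro sum_mono term_le)
      also have "\<dots> = 6 * (\<Sum>j\<in>A. ?g (j + J))" by (simp only: sum_distrib_left)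
      also have "\<dots> \<le> 6 * (\<Sum>j. ?g (j + J))"
        by (intro mult_left_mono sum_le_suminf summable_ignore_initial_segment[OF g] that ballI
            nonneg) simp
      also have "\<dots> \<le> 6 * (1 / 12)"
        using J0[of J] by (intro mult_left_mono) (auto simp: J_def)
      finally show ?thesis by simp
    qed
    \<comment> \<open>the index $0$ is excluded because $\ln 1 = 0$\<close>
    show "(c j)\<^sup>2 \<le> (4 * (1 + ln (real (J + 1)) / ln 2)) * ln (real (Suc j))" if "1 \<le> j" for j
    proof -
      have "ln (?L (j + J)) \<le> ?L (j + J)" using L2[of j] by (smt (verit) ln_bound)
      then have "(c j)\<^sup>2 \<le> 4 * ?L (j + J)" unfolding c_sq log by simp
      also have "?L (j + J) \<le> ln (real (Suc j) * real (J + 1))"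
        unfolding of_nat_mult[symmetric] by (intro ln_mono) simp_all
      also have "\<dots> = ln (real (Suc j)) + ln (real (J + 1)) / ln 2 * ln 2"
        by (simp add: ln_mult_pos)
      also have "\<dots> \<le> ln (real (Suc j)) + ln (real (J + 1)) / ln 2 * ln (real (Suc j))"
        using that by (intro add_left_mono mult_left_mono) auto
      finally show ?thesis by (simp add: algebra_simps)
    qed
  qed
qed

section \<open>Test fields\<close>

lemma prod_split_one:
  fixes f :: "nat \<Rightarrow> real"
  assumes "j < n"
  shows "(\<Prod>i<n. f i) = f j * (\<Prod>i\<in>{..<n} - {j}. f i)"
  using assms by (simp add: prod.remove)

lemma continuous_map_Euclidean_space:
  "continuous_on UNIV \<phi> \<Longrightarrow> continuous_map (Euclidean_space m) euclideanreal \<phi>"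
  unfolding Euclidean_space_def euclidean_product_topology
  by (auto elim: continuous_on_subset)

lemma C1_bounded_prod:
  fixes u u' :: "nat \<Rightarrow> real \<Rightarrow> real"
  assumes deriv: "\<And>i t. i < m \<Longrightarrow> (u i has_field_derivative u' i t) (at t)"
    and cont: "\<And>i. i < m \<Longrightarrow> continuous_on UNIV (u' i)"
    and bound: "\<And>i t. i < m \<Longrightarrow> \<bar>u i t\<bar> \<le> B i"
    and bound': "\<And>i t. i < m \<Longrightarrow> \<bar>u' i t\<bar> \<le> B' i"
  shows "C1_bounded m (\<lambda>v. \<Prod>i<m. u i (v i))"
proof -
  let ?\<phi> = "\<lambda>v. \<Prod>i<m. u i (v i)"
  have cont_coord: "continuous_on UNIV (\<lambda>v :: nat \<Rightarrow> real. f (v i))"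
    if "continuous_on UNIV f" for f :: "real \<Rightarrow> real" and i
    by (rule continuous_on_compose2[OF that continuous_on_product_coordinates]) simp
  have u_cont: "continuous_on UNIV (u i)" if "i < m" for i
    using deriv[OF that] by (intro continuous_at_imp_continuous_on ballI DERIV_isCont)
  have split: "?\<phi> (v(i := t)) = u i t * (\<Prod>k\<in>{..<m} - {i}. u k (v k))" if "i < m" for v i t
    unfolding prod_split_one[OF that] by (intro arg_cong2[where f = "(*)"] prod.cong) auto
  have d: "((\<lambda>t. ?\<phi> (v(i := t))) has_field_derivative
      u' i t * (\<Prod>k\<in>{..<m} - {i}. u k (v k))) (at t)" if "i < m" for v i t
    unfolding split[OF that] by (intro DERIV_cmult_right deriv that)
  have pd: "partial_deriv i ?\<phi> = (\<lambda>v. u' i (v i) * (\<Prod>k\<in>{..<m} - {i}. u k (v k)))" if "i < m" for i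
    unfolding partial_deriv_def using DERIV_imp_deriv[OF d[OF that]] by auto
  have abs_prod: "\<bar>\<Prod>k\<in>J. u k (v k)\<bar> \<le> (\<Prod>k\<in>J. B k)" if "J \<subseteq> {..<m}" for J v
    unfolding abs_prod using that by (intro prod_mono) (auto intro: bound)
  show ?thesis
    unfolding C1_bounded_def
  proof (intro conjI allI impI ballI)
    show "continuous_map (Euclidean_space m) euclideanreal ?\<phi>"
      by (intro continuous_map_Euclidean_space continuous_on_prod cont_coord u_cont) simp
    show "bounded (?\<phi> ` topspace (Euclidean_space m))"
      using abs_prod[of "{..<m}"] by (auto simp: bounded_iff)
  next
    fix i assume i: "i < m"
    show "(\<lambda>t. ?\<phi> (v(i := t))) differentiable at (v i)" for v
      using d[OF i] by (auto simp: real_differentiable_def)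
    show "continuous_map (Euclidean_space m) euclideanreal (partial_deriv i ?\<phi>)"
      unfolding pd[OF i]
      by (intro continuous_map_Euclidean_space continuous_on_mult continuous_on_prod cont_coord
          u_cont cont i) simp
    show "bounded (partial_deriv i ?\<phi> ` topspace (Euclidean_space m))"
      unfolding pd[OF i] bounded_iff
    proof (intro exI ballI)
      fix y assume "y \<in> (\<lambda>v. u' i (v i) * (\<Prod>k\<in>{..<m} - {i}. u k (v k))) ` topspace (Euclidean_space m)"
      then obtain v where "y = u' i (v i) * (\<Prod>k\<in>{..<m} - {i}. u k (v k))" by blast
      then show "norm y \<le> B' i * (\<Prod>k\<in>{..<m} - {i}. B k)"
        using bound'[OF i, of "v i"]
        by (auto simp: abs_mult intro!: mult_mono abs_prod)
    qed
  qed
qed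

text \<open>If independent events have probabilities $p_i$, then the $j$-th summand is the probability
  that the $j$-th event alone happens.\<close>

lemma sum_exactly_one_le_1:
  fixes p :: "nat \<Rightarrow> real"
  assumes p: "\<And>i. 0 \<le> p i" "\<And>i. p i \<le> 1"
  shows "(\<Sum>j<n. \<Prod>i<n. if i = j then p i else 1 - p i) \<le> 1"
proof -
  have "(\<Sum>j<n. \<Prod>i<n. if i = j then p i else 1 - p i) + (\<Prod>i<n. 1 - p i) \<le> 1"
  proof (induction n)
    case (Suc n)
    let ?S = "\<Sum>j<n. \<Prod>i<n. if i = j then p i else 1 - p i" and ?P = "\<Prod>i<n. 1 - p i"
    have "(\<Sum>j<Suc n. \<Prod>i<Suc n. if i = j then p i else 1 - p i) = ?S * (1 - p n) + ?P * p n"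
      by (simp add: sum_distrib_right)
    moreover have "?S * (1 - p n) \<le> ?S"
      using p by (intro mult_right_le_one_le sum_nonneg prod_nonneg) auto
    ultimately show ?case using Suc by (simp add: algebra_simps)
  qed simp
  moreover have "0 \<le> (\<Prod>i<n. 1 - p i)" using p by (intro prod_nonneg) simp
  ultimately show ?thesis by linarith
qed

lemma sum_square_exactly_one_le_1:
  fixes p :: "nat \<Rightarrow> real"
  assumes p: "\<And>i. 0 \<le> p i" "\<And>i. p i \<le> 1"
  shows "(\<Sum>j<n. (\<Prod>i<n. if i = j then p i else 1 - p i)\<^sup>2) \<le> 1"
proof -
  have "(\<Sum>j<n. (\<Prod>i<n. if i = j then p i else 1 - p i)\<^sup>2) \<le>
      (\<Sum>j<n. \<Prod>i<n. if i = j then p i else 1 - p i)"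
    using p by (intro sum_mono) (auto simp: power2_eq_square intro!: mult_left_le prod_le_1 prod_nonneg)
  then show ?thesis using sum_exactly_one_le_1[of p n, OF p] by linarith
qed

context gaussian_eigenbasis
begin

lemma h_hat_shift:
  "h_hat e lam i (x + t *\<^sub>R CM_basis e lam j) = h_hat e lam i x + (if i = j then t else 0)"
  using lam_pos[of j] by (simp add: h_hat_def CM_basis_def inner_add_left basis_inner add_divide_distrib)

text \<open>On the face $\hat h_j = c_j$ the field should point outwards.  Its $j$-th component vanishes
  away from that face and is $1/2$ on it, except near the edges, where several faces share the
  bound on the norm.\<close>

definition test_coeff :: "(nat \<Rightarrow> real) \<Rightarrow> nat \<Rightarrow> nat \<Rightarrow> 'a \<Rightarrow> real" where
  "test_coeff c n j x =
     (\<Prod>i<n. if i = j then smooth_step (c i) (h_hat e lam i x) else 1 - smooth_step (c i) (h_hat e lam i x))"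

definition test_field :: "(nat \<Rightarrow> real) \<Rightarrow> nat \<Rightarrow> 'a \<Rightarrow> 'a" where
  "test_field c n x = (\<Sum>j<n. test_coeff c n j x *\<^sub>R CM_basis e lam j)"

lemma test_coeff_FC1b:
  assumes c: "\<And>i. 0 \<le> c i"
  shows "test_coeff c n j \<in> FC1b"
proof -
  let ?u = "\<lambda>i t. if i = j then smooth_step (c i) t else 1 - smooth_step (c i) t"
  let ?u' = "\<lambda>i t. if i = j then smooth_step_deriv (c i) t else - smooth_step_deriv (c i) t"
  let ?l = "\<lambda>i. (1 / sqrt (lam i)) *\<^sub>R e i"
  have "C1_bounded n (\<lambda>v. \<Prod>i<n. ?u i (v i))"
  proof (rule C1_bounded_prod)
    fix i t
    show "(?u i has_field_derivative ?u' i t) (at t)"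
      by (auto intro!: derivative_eq_intros DERIV_smooth_step)
    show "continuous_on UNIV (?u' i)"
      by (cases "i = j") (simp_all add: continuous_smooth_step_deriv continuous_on_minus)
    show "\<bar>?u i t\<bar> \<le> 1"
      using smooth_step_nonneg[of "c i" t] smooth_step_le_1[of "c i" t] by auto
    show "\<bar>?u' i t\<bar> \<le> 2 * c i"
      using smooth_step_deriv_bounded[OF c, of i t] by auto
  qed
  moreover have "test_coeff c n j = (\<lambda>x. (\<lambda>v. \<Prod>i<n. ?u i (v i)) (\<lambda>i. if i < n then x \<bullet> ?l i else 0))"
    by (rule ext) (auto simp: test_coeff_def h_hat_def intro!: prod.cong)
  ultimately show ?thesis
    unfolding FC1b_def
    by (intro CollectI exI[of _ n] exI[of _ ?l] exI[of _ "\<lambda>v. \<Prod>i<n. ?u i (v i)"] conjI)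
qed

lemma test_field_in_FC1b_fields:
  assumes "\<And>i. 0 \<le> c i"
  shows "test_field c n \<in> FC1b_fields Q"
  unfolding FC1b_fields_def
  by (intro CollectI exI[of _ n] exI[of _ "\<lambda>_. 1"] exI[of _ "test_coeff c n"]
      exI[of _ "CM_basis e lam"])
    (auto simp: test_field_def[abs_def] test_coeff_FC1b[OF assms] CM_basis_in_CM_space)

text \<open>At each point the step values act as probabilities of independent events, and the $j$-th
  coefficient is the probability that the $j$-th event alone happens.\<close>

lemma CM_norm_test_field: "CM_norm Q (test_field c n x) \<le> 1"
  unfolding test_field_def test_coeff_def
  by (simp add: CM_norm_basis sum_square_exactly_one_le_1 smooth_step_nonneg smooth_step_le_1)

text \<open>The $j$-th coefficient depends on the $j$-th coordinate through a single factor, so the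
  divergence is again a sum of products of functions of one coordinate each.\<close>

lemma gauss_div_test_field:
  "gauss_div Q e lam (test_field c n) x =
    (\<Sum>j<n. \<Prod>i<n. (if i = j
      then smooth_step_deriv (c i) (h_hat e lam i x) - h_hat e lam i x * smooth_step (c i) (h_hat e lam i x)
      else 1 - smooth_step (c i) (h_hat e lam i x)))"
proof -
  have inner: "CM_inner Q (test_field c n y) (CM_basis e lam j) = (if j < n then test_coeff c n j y else 0)"
    for y j
    by (simp add: test_field_def CM_inner_basis)
  have "dir_deriv_adj e lam j (test_coeff c n j) x = (\<Prod>i<n. (if i = j
      then smooth_step_deriv (c i) (h_hat e lam i x) - h_hat e lam i x * smooth_step (c i) (h_hat e lam i x)
      else 1 - smooth_step (c i) (h_hat e lam i x)))" if "j < n" for j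
  proof -
    define R where "R = (\<Prod>i\<in>{..<n} - {j}. 1 - smooth_step (c i) (h_hat e lam i x))"
    have coeff: "test_coeff c n j (x + t *\<^sub>R CM_basis e lam j) = smooth_step (c j) (h_hat e lam j x + t) * R" for t
      unfolding test_coeff_def prod_split_one[OF that] R_def
      by (intro arg_cong2[where f = "(*)"] prod.cong) (auto simp: h_hat_shift)
    have "((\<lambda>t. smooth_step (c j) (h_hat e lam j x + t) * R) has_field_derivative
        smooth_step_deriv (c j) (h_hat e lam j x + 0) * 1 * R) (at 0)"
      by (intro DERIV_cmult_right DERIV_chain2[OF DERIV_smooth_step]) (auto intro!: derivative_eq_intros)
    then have "dir_deriv e lam j (test_coeff c n j) x = smooth_step_deriv (c j) (h_hat e lam j x) * R"
      unfolding dir_deriv_def coeff by (simp add: DERIV_imp_deriv)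
    moreover have "test_coeff c n j x = smooth_step (c j) (h_hat e lam j x) * R"
      using coeff[of 0] by simp
    ultimately show ?thesis
      unfolding prod_split_one[OF that]
      by (simp add: dir_deriv_adj_def R_def algebra_simps)
  qed
  moreover have "dir_deriv_adj e lam j (\<lambda>y. 0) x = 0" for j
    by (simp add: dir_deriv_adj_def dir_deriv_def)
  ultimately have "dir_deriv_adj e lam j (\<lambda>y. CM_inner Q (test_field c n y) (CM_basis e lam j)) x =
     (if j < n then (\<Prod>i<n. (if i = j
      then smooth_step_deriv (c i) (h_hat e lam i x) - h_hat e lam i x * smooth_step (c i) (h_hat e lam i x)
      else 1 - smooth_step (c i) (h_hat e lam i x))) else 0)" for j
    by (cases "j < n") (simp_all add: inner)
  then show ?thesis
    unfolding gauss_div_def by (subst suminf_finite[of "{..<n}"]) auto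
qed

section \<open>The box\<close>

definition coord_box :: "(nat \<Rightarrow> real) \<Rightarrow> 'a set" where
  "coord_box c = {x. \<forall>j. \<bar>x \<bullet> e j\<bar> \<le> sqrt (lam j) * c j}"

lemma mem_coord_box_iff: "x \<in> coord_box c \<longleftrightarrow> (\<forall>j. h_hat e lam j x \<in> {- c j..c j})"
proof -
  have "\<bar>x \<bullet> e j\<bar> \<le> sqrt (lam j) * c j \<longleftrightarrow> h_hat e lam j x \<in> {- c j..c j}" for j
  proof -
    have "\<bar>x \<bullet> e j\<bar> \<le> sqrt (lam j) * c j \<longleftrightarrow> \<bar>h_hat e lam j x\<bar> \<le> c j"
      using lam_pos[of j] by (simp add: h_hat_def abs_divide pos_divide_le_eq mult.commute)
    then show ?thesis by (auto simp: abs_le_iff)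
  qed
  then show ?thesis by (simp add: coord_box_def)
qed

lemma closed_coord_box: "closed (coord_box c)"
  unfolding coord_box_def by (intro closed_Collect_all closed_Collect_le continuous_intros)

lemma convex_coord_box: "convex (coord_box c)"
proof (rule convexI)
  fix x y and u v :: real
  assume x: "x \<in> coord_box c" and y: "y \<in> coord_box c" and uv: "0 \<le> u" "0 \<le> v" "u + v = 1"
  have "\<bar>(u *\<^sub>R x + v *\<^sub>R y) \<bullet> e j\<bar> \<le> sqrt (lam j) * c j" for j
  proof -
    have "\<bar>(u *\<^sub>R x + v *\<^sub>R y) \<bullet> e j\<bar> \<le> u * \<bar>x \<bullet> e j\<bar> + v * \<bar>y \<bullet> e j\<bar>"
      using uv abs_triangle_ineq[of "u * (x \<bullet> e j)" "v * (y \<bullet> e j)"]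
      by (simp add: inner_add_left abs_mult)
    also have "\<dots> \<le> sqrt (lam j) * c j"
      using x y uv by (intro convex_bound_le) (auto simp: coord_box_def)
    finally show ?thesis .
  qed
  then show "u *\<^sub>R x + v *\<^sub>R y \<in> coord_box c" by (simp add: coord_box_def)
qed

lemma compact_coord_box:
  assumes "summable (\<lambda>j. lam j * (c j)\<^sup>2)"
  shows "compact (coord_box c)"
  unfolding coord_box_def using assms lam_pos
  by (intro compact_orthonormal_box basis) (simp add: power_mult_distrib less_imp_le)

text \<open>By independence the integral over the box truncated to the first $N$ coordinates is a product
  of one-dimensional integrals.  The $j$-th factor is the boundary value at $c_j$, and the others
  are close enough to $1$ for their product to stay above $1/2$, uniformly in $N$.\<close>

lemma integral_box_test_term:
  assumes c: "\<And>j. 2 \<le> c j"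
    and small: "\<And>A. finite A \<Longrightarrow> (\<Sum>j\<in>A. 6 * exp (- (c j)\<^sup>2 / 2) / c j) \<le> 1 / 2"
    and "j < n"
  defines "g \<equiv> \<lambda>x. indicator (coord_box c) x * (\<Prod>i<n. (if i = j
      then smooth_step_deriv (c i) (h_hat e lam i x) - h_hat e lam i x * smooth_step (c i) (h_hat e lam i x)
      else 1 - smooth_step (c i) (h_hat e lam i x)))"
  shows "integrable \<gamma> g" and "std_normal_density (c j) / 4 \<le> (\<integral>x. g x \<partial>\<gamma>)"
proof -
  define w where "w i t = (if i = j then smooth_step_deriv (c i) t - t * smooth_step (c i) t
    else if i < n then 1 - smooth_step (c i) t else 1)" for i t
  define f where "f i t = indicator {- c i..c i} t * w i t" for i t
  define G where "G N x = (\<Prod>i<N. f i (h_hat e lam i x))" for N x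
  define \<tau> where "\<tau> i = 6 * exp (- (c i)\<^sup>2 / 2) / c i" for i
  have [measurable]: "f i \<in> borel_measurable borel" for i
    unfolding f_def w_def by measurable
  have f_le: "\<bar>f i t\<bar> \<le> (if i = j then 3 * c j else 1)" for i t
  proof (cases "i = j \<and> t \<in> {- c i..c i}")
    case True
    have "\<bar>t * smooth_step (c i) t\<bar> \<le> c i * 1"
      unfolding abs_mult using True smooth_step_nonneg[of "c i" t] smooth_step_le_1[of "c i" t]
      by (intro mult_mono) auto
    then have "\<bar>smooth_step_deriv (c i) t - t * smooth_step (c i) t\<bar> \<le> 3 * c i"
      using smooth_step_deriv_bounded[of "c i" t] c[of i] by linarith
    then show ?thesis using True by (auto simp: f_def w_def)
  next
    case False
    then show ?thesis
      using smooth_step_nonneg[of "c i" t] smooth_step_le_1[of "c i" t] c[of j]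
      by (auto simp: f_def w_def split: split_indicator)
  qed
  have G_le: "\<bar>G N x\<bar> \<le> 3 * c j" for N x
  proof -
    have "\<bar>G N x\<bar> \<le> (\<Prod>i<N. if i = j then 3 * c j else 1)"
      unfolding G_def abs_prod by (intro prod_mono conjI abs_ge_zero f_le)
    also have "\<dots> \<le> 3 * c j" using c[of j] by (simp add: prod.delta)
    finally show ?thesis .
  qed
  have G_lim: "(\<lambda>N. G N x) \<longlonglongrightarrow> g x" for x
  proof (rule tendsto_eventually)
    show "\<forall>\<^sub>F N in sequentially. G N x = g x"
    proof (cases "x \<in> coord_box c")
      case True
      have "G N x = g x" if "n \<le> N" for N
      proof -
        have "G N x = (\<Prod>i<N. w i (h_hat e lam i x))"
          using True unfolding G_def f_def mem_coord_box_iff by simp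
        also have "\<dots> = (\<Prod>i<n. w i (h_hat e lam i x))"
          using that \<open>j < n\<close> by (intro prod.mono_neutral_right) (auto simp: w_def)
        also have "\<dots> = g x"
          using True unfolding g_def w_def by (auto intro!: prod.cong)
        finally show ?thesis .
      qed
      then show ?thesis by (auto simp: eventually_sequentially)
    next
      case False
      then obtain i where "h_hat e lam i x \<notin> {- c i..c i}" by (auto simp: mem_coord_box_iff)
      then have "f i (h_hat e lam i x) = 0" by (simp add: f_def)
      then have "G N x = g x" if "Suc i \<le> N" for N
        using that False unfolding G_def g_def by (auto intro!: prod_zero)
      then show ?thesis by (auto simp: eventually_sequentially)
    qed
  qed
  have [measurable]: "G N \<in> borel_measurable \<gamma>" for N
    unfolding G_def by measurable
  have [measurable]: "g \<in> borel_measurable \<gamma>"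
    by (rule borel_measurable_LIMSEQ_real[OF G_lim]) auto
  have dc: "integrable \<gamma> g" "(\<lambda>N. \<integral>x. G N x \<partial>\<gamma>) \<longlonglongrightarrow> (\<integral>x. g x \<partial>\<gamma>)"
    by (rule integrable_dominated_convergence[where s = G and w = "\<lambda>_. 3 * c j"]
        integral_dominated_convergence[where w = "\<lambda>_. 3 * c j"]; simp add: G_lim G_le)+
  show "integrable \<gamma> g" by (rule dc)
  have int_f: "(\<integral>t. f j t \<partial>std_normal_distribution) = std_normal_density (c j) / 2"
    using integral_gauss_div_smooth_step[OF c] by (simp add: f_def w_def)
  have int_f_ge: "1 - \<tau> i \<le> (\<integral>t. f i t \<partial>std_normal_distribution)" if "i \<noteq> j" for i
  proof -
    have "1 - \<tau> i \<le> (\<integral>t. indicator {- c i..c i} t * (1 - smooth_step (c i) t) \<partial>std_normal_distribution)"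
      unfolding \<tau>_def by (rule integral_one_minus_smooth_step[OF c])
    also have "\<dots> \<le> (\<integral>t. f i t \<partial>std_normal_distribution)"
    proof (rule integral_mono)
      show "integrable std_normal_distribution (f i)"
        by (rule integrable_std_normal_bounded) (use f_le in auto)
      show "integrable std_normal_distribution (\<lambda>t. indicator {- c i..c i} t * (1 - smooth_step (c i) t))"
      proof (rule integrable_std_normal_bounded)
        show "\<bar>indicator {- c i..c i} t * (1 - smooth_step (c i) t)\<bar> \<le> 1" for t
          using smooth_step_nonneg[of "c i" t] smooth_step_le_1[of "c i" t] by (auto split: split_indicator)
      qed simp
      show "indicator {- c i..c i} t * (1 - smooth_step (c i) t) \<le> f i t" for t
        using that smooth_step_nonneg[of "c i" t] by (auto simp: f_def w_def split: split_indicator)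
    qed
    finally show ?thesis .
  qed
  have "std_normal_density (c j) / 4 \<le> (\<integral>x. G N x \<partial>\<gamma>)" if "n \<le> N" for N
  proof -
    have jN: "j < N" using that \<open>j < n\<close> by simp
    have \<tau>: "0 \<le> \<tau> i" "\<tau> i \<le> 1" for i
      using small[of "{i}"] c[of i] by (auto simp: \<tau>_def)
    have "1 / 2 \<le> 1 - (\<Sum>i\<in>{..<N} - {j}. \<tau> i)"
      using small[of "{..<N} - {j}"] by (simp add: \<tau>_def)
    also have "\<dots> \<le> (\<Prod>i\<in>{..<N} - {j}. 1 - \<tau> i)"
      using \<tau> by (intro Weierstrass_prod_ineq) auto
    also have "\<dots> \<le> (\<Prod>i\<in>{..<N} - {j}. \<integral>t. f i t \<partial>std_normal_distribution)"
      using \<tau> int_f_ge by (intro prod_mono) auto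
    finally have "std_normal_density (c j) / 2 * (1 / 2) \<le>
        std_normal_density (c j) / 2 * (\<Prod>i\<in>{..<N} - {j}. \<integral>t. f i t \<partial>std_normal_distribution)"
      by (intro mult_left_mono) auto
    also have "\<dots> = (\<Prod>i<N. \<integral>t. f i t \<partial>std_normal_distribution)"
      unfolding prod_split_one[OF jN] int_f ..
    also have "\<dots> = (\<integral>x. G N x \<partial>\<gamma>)"
      unfolding G_def by (rule integral_prod_h_hat[symmetric]) (auto intro: f_le)
    finally show ?thesis by simp
  qed
  then show "std_normal_density (c j) / 4 \<le> (\<integral>x. g x \<partial>\<gamma>)"
    by (intro LIMSEQ_le_const[OF dc(2)]) blast
qed

text \<open>Each face contributes a fixed fraction of its density $\varphi(c_j)$ to the flux of the test
  field, and these contributions are not summable.\<close>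

lemma gauss_perimeter_coord_box:
  assumes c: "\<And>j. 2 \<le> c j"
    and small: "\<And>A. finite A \<Longrightarrow> (\<Sum>j\<in>A. 6 * exp (- (c j)\<^sup>2 / 2) / c j) \<le> 1 / 2"
    and diverges: "\<not> summable (\<lambda>j. exp (- (c j)\<^sup>2 / 2))"
  shows "gauss_perimeter \<gamma> Q e lam (coord_box c) = \<infinity>"
proof -
  let ?A = "{F \<in> FC1b_fields Q. \<forall>x. CM_norm Q (F x) \<le> 1}"
  have field: "test_field c n \<in> ?A" for n
    using c by (auto intro!: test_field_in_FC1b_fields CM_norm_test_field order_trans[OF _ c])
  have lower: "(\<Sum>j<n. std_normal_density (c j) / 4) \<le>
      (LINT x:coord_box c|\<gamma>. gauss_div Q e lam (test_field c n) x)" for n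
    unfolding set_lebesgue_integral_def gauss_div_test_field real_scaleR_def sum_distrib_left
    by (subst Bochner_Integration.integral_sum)
      (auto intro!: sum_mono integral_box_test_term[OF c small])
  have unbounded: "\<exists>n. B < (\<Sum>j<n. std_normal_density (c j) / 4)" for B
  proof (rule ccontr)
    assume "\<not> ?thesis"
    then have "summable (\<lambda>j. std_normal_density (c j) / 4)"
      by (intro summableI_nonneg_bounded[where x = B]) (auto simp: not_less)
    then have "summable (\<lambda>j. (4 * sqrt (2 * pi)) * (std_normal_density (c j) / 4))"
      by (rule summable_mult)
    then show False using diverges by (simp add: std_normal_density_def)
  qed
  show ?thesis
    unfolding gauss_perimeter_def
  proof (rule SUP_PInfty)
    fix k :: nat
    obtain n where n: "real k < (\<Sum>j<n. std_normal_density (c j) / 4)"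
      using unbounded by blast
    show "\<exists>F\<in>?A. ereal (real k) \<le> ereal (LINT x:coord_box c|\<gamma>. gauss_div Q e lam F x)"
      using n lower[of n] field[of n] by (intro bexI[of _ "test_field c n"]) auto
  qed
qed

end

section \<open>Infinite perimeter and compactness\<close>

theorem proposition10:
  fixes \<gamma> :: "'a::{real_inner, polish_space} measure"
    and Q :: "'a \<Rightarrow> 'a"
    and e :: "nat \<Rightarrow> 'a"
    and lam :: "nat \<Rightarrow> real"
  assumes "\<not> (\<exists>B::'a set. finite B \<and> span B = UNIV)"
    and "centered_gaussian \<gamma>"
    and "covariance_operator \<gamma> Q"
    and "inj Q"
    and "ordered_eigenbasis Q e lam"
  shows "\<exists>C::'a set. closed C \<and> convex C \<and> gauss_perimeter \<gamma> Q e lam C = \<infinity> \<and>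
           (summable (\<lambda>j. lam j * ln (real (Suc j))) \<longrightarrow> compact C)"
proof -
  interpret gaussian_eigenbasis \<gamma> Q e lam
    by (rule gaussian_eigenbasis.intro) (fact assms)+
  obtain c :: "nat \<Rightarrow> real" and K where c: "\<And>j. 2 \<le> c j"
    and diverges: "\<not> summable (\<lambda>j. exp (- (c j)\<^sup>2 / 2))"
    and small: "\<And>A. finite A \<Longrightarrow> (\<Sum>j\<in>A. 6 * exp (- (c j)\<^sup>2 / 2) / c j) \<le> 1 / 2"
    and log: "\<And>j. 1 \<le> j \<Longrightarrow> (c j)\<^sup>2 \<le> K * ln (real (Suc j))"
    by (rule obtain_side_lengths) (rule that; blast)
  have "compact (coord_box c)" if s: "summable (\<lambda>j. lam j * ln (real (Suc j)))"
  proof (rule compact_coord_box)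
    show "summable (\<lambda>j. lam j * (c j)\<^sup>2)"
    proof (rule summable_comparison_test'[OF summable_mult[OF s, of K]])
      fix j :: nat assume "1 \<le> j"
      then have "lam j * (c j)\<^sup>2 \<le> lam j * (K * ln (real (Suc j)))"
        using log lam_pos[of j] by (intro mult_left_mono) auto
      then show "norm (lam j * (c j)\<^sup>2) \<le> K * (lam j * ln (real (Suc j)))"
        using lam_pos[of j] by (simp add: mult.left_commute)
    qed
  qed
  then show ?thesis
    using closed_coord_box convex_coord_box gauss_perimeter_coord_box[OF c small diverges] by blast
qed

end
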